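(* Let $G=(V,E)$ be a $k$-regular graph with adjacency eigenvalues $\vartheta_1\ge\vartheta_2\ge\dots\ge\vartheta_n$, and suppose the chromatic number $\chi(G)$ is even and equals $1-\vartheta_1/\vartheta_n$. Then either both $G$ and its complement $\overline G$ are class 1, or $\overline G$ is a disjoint union of cliques of odd order.
   Context: The chromatic number $\chi(G)$ is the minimum number of colours in a proper vertex colouring. Hoffman's bound states $\chi(G)\ge 1-\vartheta_1/\vartheta_n$. A graph of maximum degree $\Delta$ is class 1 if its chromatic index (minimum number of colours in a proper edge-colouring) equals $\Delta$. *)

theory Defs
  imports "HOL-Library.Disjoint_Sets" "Jordan_Normal_Form.Char_Poly"
begin

definition all_edges :: "'a set \<Rightarrow> 'a set set" where
  "all_edges V = {e. e \<subseteq> V \<and> card e = 2}"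

definition simple_graph :: "'a set \<Rightarrow> 'a set set \<Rightarrow> bool" where
  "simple_graph V E \<longleftrightarrow> finite V \<and> E \<subseteq> all_edges V"

definition complement_edges :: "'a set \<Rightarrow> 'a set set \<Rightarrow> 'a set set" where
  "complement_edges V E = all_edges V - E"

definition vertex_degree :: "'a set set \<Rightarrow> 'a \<Rightarrow> nat" where
  "vertex_degree E v = card {e \<in> E. v \<in> e}"

definition regular :: "'a set \<Rightarrow> 'a set set \<Rightarrow> nat \<Rightarrow> bool" where
  "regular V E k \<longleftrightarrow> (\<forall>v\<in>V. vertex_degree E v = k)"

(* Only meaningful for finite nonempty V. *)
definition max_degree :: "'a set \<Rightarrow> 'a set set \<Rightarrow> nat" where
  "max_degree V E = Max (vertex_degree E ` V)"

definition proper_vertex_colouring :: "'a set \<Rightarrow> 'a set set \<Rightarrow> nat \<Rightarrow> ('a \<Rightarrow> nat) \<Rightarrow> bool" where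
  "proper_vertex_colouring V E m c \<longleftrightarrow>
     (\<forall>v\<in>V. c v < m) \<and> (\<forall>u\<in>V. \<forall>v\<in>V. {u, v} \<in> E \<longrightarrow> c u \<noteq> c v)"

definition chromatic_number :: "'a set \<Rightarrow> 'a set set \<Rightarrow> nat" where
  "chromatic_number V E = (LEAST m. \<exists>c. proper_vertex_colouring V E m c)"

definition proper_edge_colouring :: "'a set set \<Rightarrow> nat \<Rightarrow> ('a set \<Rightarrow> nat) \<Rightarrow> bool" where
  "proper_edge_colouring E m c \<longleftrightarrow>
     (\<forall>e\<in>E. c e < m) \<and> (\<forall>e\<in>E. \<forall>f\<in>E. e \<noteq> f \<and> e \<inter> f \<noteq> {} \<longrightarrow> c e \<noteq> c f)"

definition chromatic_index :: "'a set set \<Rightarrow> nat" where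
  "chromatic_index E = (LEAST m. \<exists>c. proper_edge_colouring E m c)"

definition class_1 :: "'a set \<Rightarrow> 'a set set \<Rightarrow> bool" where
  "class_1 V E \<longleftrightarrow> chromatic_index E = max_degree V E"

definition adj_matrix :: "'a set set \<Rightarrow> 'a list \<Rightarrow> real mat" where
  "adj_matrix E vs = mat (length vs) (length vs) (\<lambda>(i, j). if {vs ! i, vs ! j} \<in> E then 1 else 0)"

(* The list vs enumerates the vertices. A different enumeration conjugates the adjacency
   matrix by a permutation matrix, so the characteristic polynomial does not depend on it.
   The values of \<theta> outside {1..card V} are irrelevant. *)
definition adjacency_eigenvalues :: "'a set \<Rightarrow> 'a set set \<Rightarrow> (nat \<Rightarrow> real) \<Rightarrow> bool" where
  "adjacency_eigenvalues V E \<theta> \<longleftrightarrow>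
     (\<exists>vs. distinct vs \<and> set vs = V \<and>
        char_poly (adj_matrix E vs) = (\<Prod>i\<in>{1..card V}. [:- \<theta> i, 1:])) \<and>
     (\<forall>i\<in>{1..card V}. \<forall>j\<in>{1..card V}. i \<le> j \<longrightarrow> \<theta> j \<le> \<theta> i)"

definition disjoint_union_of_odd_cliques :: "'a set \<Rightarrow> 'a set set \<Rightarrow> bool" where
  "disjoint_union_of_odd_cliques V E \<longleftrightarrow>
     (\<exists>P. partition_on V P \<and> (\<forall>C\<in>P. odd (card C)) \<and> E = (\<Union>C\<in>P. all_edges C))"

end

theory Submission
  imports Defs
begin

text \<open>Equality in Hoffman's bound makes an optimal colouring equitable: all colour classes have the
  same size $s$, and each vertex has exactly $t = -\vartheta_n$ neighbours in every class other than
  its own. Since $\chi$ is even, the complete graph on the colours has a 1-factorisation, and each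
  edge of it carries a regular bipartite graph, which is 1-factorable by Koenig's theorem; this
  makes $G$ class 1. In the complement, the classes are cliques joined by $(s-t)$-regular
  bipartite graphs. Pairing the classes along one 1-factor, two cliques and the bipartite graph
  between them can be coloured with $s - 1 + (s - t)$ colours: for even $s$ colour the cliques
  separately, for odd $s > t$ use a perfect matching of the bipartite graph to absorb the colour
  missing at each vertex. The remaining case, $s = t$ odd, is the second alternative.\<close>

section \<open>Rayleigh quotients of symmetric matrices\<close>

text \<open>Both graphs are regular, so class 1 asks for colourings with exactly as many colours as
  the degree, and no colour may be wasted. Between the classes this is automatic once
  \<open>m\<close> is even: every edge of a 1-factorised complete graph is replaced by a bipartite
  graph that is itself 1-factorable. The obstacle lies inside the classes of the complement, where
  an odd clique on \<open>s \<ge> 3\<close> vertices needs \<open>s\<close> colours at degree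
  \<open>s - 1\<close>. With \<open>s\<close> colours every vertex of the clique misses exactly one,
  and only an edge to another class can use it; the complement has such edges exactly when
  \<open>t < s\<close>, hence the exceptional case. On the spectral side, tightness comes from a
  sum: the slacks of the ratio bounds are nonnegative and, since \<open>\<theta> 1 \<le> k\<close>,
  add up to at most 0.\<close>

lemma scalar_prod_self:
  fixes x :: "real vec"
  assumes "x \<in> carrier_vec n"
  shows "x \<bullet> x = (\<Sum>i<n. (x $ i)\<^sup>2)"
  using assms by (simp add: scalar_prod_def power2_eq_square atLeast0LessThan)

lemma scalar_prod_self_nonneg:
  fixes x :: "real vec"
  assumes "x \<in> carrier_vec n"
  shows "0 \<le> x \<bullet> x"
  by (simp add: scalar_prod_self[OF assms] sum_nonneg)

lemma scalar_prod_self_eq_0D: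
  fixes x :: "real vec"
  assumes "x \<in> carrier_vec n" and "x \<bullet> x = 0"
  shows "x = 0\<^sub>v n"
proof (rule eq_vecI)
  fix i assume i: "i < dim_vec (0\<^sub>v n)"
  have "\<forall>i\<in>{..<n}. (x $ i)\<^sup>2 = 0"
    using assms by (simp add: scalar_prod_self[OF assms(1)] sum_nonneg_eq_0_iff)
  then show "x $ i = 0\<^sub>v n $ i" using i by simp
qed (use assms in auto)

text \<open>No entry of \<open>x\<close> exceeds the norm of \<open>x\<close>, so each entry of the
  product is at most an absolute row sum times that norm.\<close>

lemma mult_mat_vec_norm_bound:
  fixes C :: "real mat"
  assumes C: "C \<in> carrier_mat n n"
  obtains K where "K > 0" "\<And>x. x \<in> carrier_vec n \<Longrightarrow> (C *\<^sub>v x) \<bullet> (C *\<^sub>v x) \<le> K * (x \<bullet> x)"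
proof
  let ?R = "\<lambda>i. \<Sum>j<n. \<bar>C $$ (i, j)\<bar>"
  \<comment> \<open>The summand 1 only keeps the constant positive when \<open>C\<close> is
    zero.\<close>
  let ?K = "1 + (\<Sum>i<n. (?R i)\<^sup>2)"
  show "?K > 0" by (smt (verit) sum_nonneg zero_le_power2)
  fix x :: "real vec" assume x: "x \<in> carrier_vec n"
  have le: "\<bar>x $ j\<bar> \<le> sqrt (x \<bullet> x)" if "j < n" for j
  proof (rule real_le_rsqrt)
    show "\<bar>x $ j\<bar>\<^sup>2 \<le> x \<bullet> x"
      unfolding scalar_prod_self[OF x] power2_abs
      by (rule member_le_sum[of j "{..<n}" "\<lambda>j. (x $ j)\<^sup>2"]) (use that in auto)
  qed
  have "((C *\<^sub>v x) $ i)\<^sup>2 \<le> (?R i)\<^sup>2 * (x \<bullet> x)" if i: "i < n" for i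
  proof -
    have "\<bar>(C *\<^sub>v x) $ i\<bar> = \<bar>\<Sum>j<n. C $$ (i, j) * x $ j\<bar>"
      using C x i by (simp add: scalar_prod_def atLeast0LessThan)
    also have "\<dots> \<le> (\<Sum>j<n. \<bar>C $$ (i, j)\<bar> * \<bar>x $ j\<bar>)"
      by (rule order_trans[OF sum_abs]) (simp add: abs_mult)
    also have "\<dots> \<le> (\<Sum>j<n. \<bar>C $$ (i, j)\<bar> * sqrt (x \<bullet> x))"
      by (intro sum_mono mult_left_mono le) auto
    also have "\<dots> = ?R i * sqrt (x \<bullet> x)"
      by (simp add: sum_distrib_right)
    finally have "\<bar>(C *\<^sub>v x) $ i\<bar>\<^sup>2 \<le> (?R i * sqrt (x \<bullet> x))\<^sup>2"
      by (rule power_mono) simp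
    then show ?thesis
      by (simp add: power_mult_distrib scalar_prod_self_nonneg[OF x])
  qed
  then have "(\<Sum>i<n. ((C *\<^sub>v x) $ i)\<^sup>2) \<le> (\<Sum>i<n. (?R i)\<^sup>2 * (x \<bullet> x))"
    by (intro sum_mono) auto
  also have "\<dots> \<le> ?K * (x \<bullet> x)"
    using scalar_prod_self_nonneg[OF x] by (simp add: sum_distrib_right distrib_right)
  finally show "(C *\<^sub>v x) \<bullet> (C *\<^sub>v x) \<le> ?K * (x \<bullet> x)"
    using C x by (subst scalar_prod_self[of _ n]) auto
qed

lemma symmetric_scalar_prod:
  fixes A :: "real mat"
  assumes "A \<in> carrier_mat n n" "A\<^sup>T = A" "x \<in> carrier_vec n" "y \<in> carrier_vec n"
  shows "x \<bullet> (A *\<^sub>v y) = y \<bullet> (A *\<^sub>v x)"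
  using transpose_vec_mult_scalar[OF assms(1) assms(4) assms(3)] assms
  by (metis comm_scalar_prod mult_mat_vec_carrier)

text \<open>Evaluate the form at $x - tBx$ with $t = 1/K$.\<close>

lemma psd_mult_mat_vec_bound:
  fixes B :: "real mat"
  assumes B: "B \<in> carrier_mat n n" "B\<^sup>T = B"
    and psd: "\<And>x. x \<in> carrier_vec n \<Longrightarrow> 0 \<le> x \<bullet> (B *\<^sub>v x)"
  obtains K where "K > 0"
    "\<And>x. x \<in> carrier_vec n \<Longrightarrow> (B *\<^sub>v x) \<bullet> (B *\<^sub>v x) \<le> K * (x \<bullet> (B *\<^sub>v x))"
proof -
  obtain K where K: "K > 0"
    "\<And>x. x \<in> carrier_vec n \<Longrightarrow> (B *\<^sub>v x) \<bullet> (B *\<^sub>v x) \<le> K * (x \<bullet> x)"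
    using mult_mat_vec_norm_bound[OF B(1)] by blast
  \<comment> \<open>Expanding |y - B y|^2 \<ge> 0 and inserting |B y|^2 \<le> K |y|^2 bounds the
    form at \<open>y\<close> by \<open>L\<close> times |y|^2. The test vector then uses the step
    length \<open>1 / L\<close>.\<close>
  define L where "L = (K + 1) / 2"
  have L: "L > 0" using K by (simp add: L_def)
  show thesis
  proof
    show "L > 0" by fact
    fix x :: "real vec" assume x: "x \<in> carrier_vec n"
    define y where "y = B *\<^sub>v x"
    have y: "y \<in> carrier_vec n" using B x by (simp add: y_def)
    have By: "B *\<^sub>v y \<in> carrier_vec n" using B y by simp
    have yBy: "y \<bullet> (B *\<^sub>v y) \<le> L * (y \<bullet> y)"
    proof -
      have "0 \<le> (y - B *\<^sub>v y) \<bullet> (y - B *\<^sub>v y)"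
        by (rule scalar_prod_self_nonneg[of _ n]) (use y By in auto)
      also have "\<dots> = y \<bullet> y - 2 * (y \<bullet> (B *\<^sub>v y)) + (B *\<^sub>v y) \<bullet> (B *\<^sub>v y)"
        using y By comm_scalar_prod[OF By y]
        by (simp add: minus_scalar_prod_distrib[of _ n] scalar_prod_minus_distrib[of _ n])
      finally show ?thesis using K(2)[OF y] by (simp add: L_def field_simps)
    qed
    have "0 \<le> (x - (1 / L) \<cdot>\<^sub>v y) \<bullet> (B *\<^sub>v (x - (1 / L) \<cdot>\<^sub>v y))"
      by (rule psd) (use x y in auto)
    also have "B *\<^sub>v (x - (1 / L) \<cdot>\<^sub>v y) = y - (1 / L) \<cdot>\<^sub>v (B *\<^sub>v y)"
      using B x y by (simp add: mult_minus_distrib_mat_vec y_def mult_mat_vec)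
    also have "(x - (1 / L) \<cdot>\<^sub>v y) \<bullet> (y - (1 / L) \<cdot>\<^sub>v (B *\<^sub>v y)) =
        x \<bullet> y - (1 / L) * (x \<bullet> (B *\<^sub>v y)) - (1 / L) * (y \<bullet> y) + (1 / L)\<^sup>2 * (y \<bullet> (B *\<^sub>v y))"
      using x y By
      by (simp add: minus_scalar_prod_distrib[of _ n] scalar_prod_minus_distrib[of _ n]
          algebra_simps power2_eq_square)
    also have "x \<bullet> (B *\<^sub>v y) = y \<bullet> y"
      using symmetric_scalar_prod[OF B x y] by (simp add: y_def)
    also have "x \<bullet> y - 1 / L * (y \<bullet> y) - 1 / L * (y \<bullet> y) + (1 / L)\<^sup>2 * (y \<bullet> (B *\<^sub>v y))
       \<le> x \<bullet> y - 1 / L * (y \<bullet> y) - 1 / L * (y \<bullet> y) + (1 / L)\<^sup>2 * (L * (y \<bullet> y))"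
      by (intro add_left_mono mult_left_mono yBy) auto
    also have "\<dots> = x \<bullet> y - (1 / L) * (y \<bullet> y)"
      using L by (simp add: field_simps power2_eq_square)
    finally show "(B *\<^sub>v x) \<bullet> (B *\<^sub>v x) \<le> L * (x \<bullet> (B *\<^sub>v x))"
      using L by (simp add: y_def field_simps)
  qed
qed

lemma shifted_mat_form:
  fixes A :: "real mat"
  assumes A: "A \<in> carrier_mat n n" and x: "x \<in> carrier_vec n"
  shows "(A - \<mu> \<cdot>\<^sub>m 1\<^sub>m n) *\<^sub>v x = A *\<^sub>v x - \<mu> \<cdot>\<^sub>v x"
    and "x \<bullet> ((A - \<mu> \<cdot>\<^sub>m 1\<^sub>m n) *\<^sub>v x) = x \<bullet> (A *\<^sub>v x) - \<mu> * (x \<bullet> x)"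
proof -
  show *: "(A - \<mu> \<cdot>\<^sub>m 1\<^sub>m n) *\<^sub>v x = A *\<^sub>v x - \<mu> \<cdot>\<^sub>v x"
  proof -
    have "(\<mu> \<cdot>\<^sub>m 1\<^sub>m n) *\<^sub>v x = \<mu> \<cdot>\<^sub>v x"
      using x by (intro eq_vecI) auto
    then show ?thesis
      using A x by (subst minus_mult_distrib_mat_vec[of _ n n]) auto
  qed
  show "x \<bullet> ((A - \<mu> \<cdot>\<^sub>m 1\<^sub>m n) *\<^sub>v x) = x \<bullet> (A *\<^sub>v x) - \<mu> * (x \<bullet> x)"
    unfolding * using A x by (subst scalar_prod_minus_distrib[of _ n]) auto
qed

lemma symmetric_shifted_mat:
  fixes A :: "real mat"
  assumes A: "A \<in> carrier_mat n n" and "A\<^sup>T = A"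
  shows "(A - \<mu> \<cdot>\<^sub>m 1\<^sub>m n)\<^sup>T = A - \<mu> \<cdot>\<^sub>m 1\<^sub>m n"
proof (rule eq_matI)
  fix i j assume "i < dim_row (A - \<mu> \<cdot>\<^sub>m 1\<^sub>m n)" "j < dim_col (A - \<mu> \<cdot>\<^sub>m 1\<^sub>m n)"
  moreover from this have "A $$ (j, i) = A $$ (i, j)"
    using A assms(2) by (metis index_transpose_mat(1) carrier_matD index_minus_mat(2,3) index_smult_mat(2,3) index_one_mat(2,3))
  ultimately show "(A - \<mu> \<cdot>\<^sub>m 1\<^sub>m n)\<^sup>T $$ (i, j) = (A - \<mu> \<cdot>\<^sub>m 1\<^sub>m n) $$ (i, j)"
    using A by auto
qed (use A in auto)

text \<open>With $\lambda$ the infimum of the Rayleigh quotient, $A - \lambda I$ is positive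
  semidefinite. Were it invertible, it would dominate a positive multiple of the identity,
  and $\lambda$ could be increased; so $\lambda$ is an eigenvalue.\<close>

lemma symmetric_form_lower_bound:
  fixes A :: "real mat"
  assumes A: "A \<in> carrier_mat n n" and sym: "A\<^sup>T = A"
    and ev: "\<And>l. eigenvalue A l \<Longrightarrow> \<mu> \<le> l"
    and x: "x \<in> carrier_vec n"
  shows "\<mu> * (x \<bullet> x) \<le> x \<bullet> (A *\<^sub>v x)"
proof (cases "n = 0")
  case True
  then show ?thesis using A x by (simp add: scalar_prod_def)
next
  case False
  \<comment> \<open>The lower bounds of the Rayleigh quotient, written without division so that
    \<open>x = 0\<close> needs no exception. The infimum of the quotient is
    \<open>Sup S\<close>.\<close>
  define S where "S = {t. \<forall>x\<in>carrier_vec n. t * (x \<bullet> x) \<le> x \<bullet> (A *\<^sub>v x)}"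
  obtain K where K: "K > 0"
    "\<And>x. x \<in> carrier_vec n \<Longrightarrow> (A *\<^sub>v x) \<bullet> (A *\<^sub>v x) \<le> K * (x \<bullet> x)"
    using mult_mat_vec_norm_bound[OF A] by blast
  \<comment> \<open>A member of \<open>S\<close> read off from |x + A x|^2 \<ge> 0.\<close>
  have "- (K + 1) / 2 \<in> S" unfolding S_def
  proof (intro CollectI ballI)
    fix x :: "real vec" assume x: "x \<in> carrier_vec n"
    let ?y = "A *\<^sub>v x"
    have y: "?y \<in> carrier_vec n" using A x by simp
    have "0 \<le> (x + ?y) \<bullet> (x + ?y)"
      by (rule scalar_prod_self_nonneg[of _ n]) (use x y in auto)
    also have "\<dots> = x \<bullet> x + 2 * (x \<bullet> ?y) + ?y \<bullet> ?y"
      using x y comm_scalar_prod[OF y x]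
      by (simp add: add_scalar_prod_distrib[of _ n] scalar_prod_add_distrib[of _ n])
    finally show "- (K + 1) / 2 * (x \<bullet> x) \<le> x \<bullet> ?y"
      using K(2)[OF x] by (simp add: field_simps)
  qed
  then have ne: "S \<noteq> {}" by blast
  \<comment> \<open>One unit vector bounds \<open>S\<close> from above; for this
    \<open>n = 0\<close> had to be split off.\<close>
  have "t \<le> unit_vec n 0 \<bullet> (A *\<^sub>v unit_vec n 0)" if "t \<in> S" for t
  proof -
    have "t * (unit_vec n 0 \<bullet> unit_vec n 0) \<le> unit_vec n 0 \<bullet> (A *\<^sub>v unit_vec n 0)"
      using that by (simp add: S_def)
    then show ?thesis using False by simp
  qed
  then have bdd: "bdd_above S" by (meson bdd_aboveI)
  define l where "l = Sup S"
  have l: "l * (x \<bullet> x) \<le> x \<bullet> (A *\<^sub>v x)" if x: "x \<in> carrier_vec n" for x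
  proof (cases "x \<bullet> x = 0")
    case True
    then have "x = 0\<^sub>v n" using scalar_prod_self_eq_0D x by blast
    then show ?thesis using A by simp
  next
    case False
    then have pos: "x \<bullet> x > 0" using scalar_prod_self_nonneg[OF x] by simp
    have "l \<le> x \<bullet> (A *\<^sub>v x) / (x \<bullet> x)" unfolding l_def
      by (rule cSup_least[OF ne]) (use pos x in \<open>auto simp: S_def field_simps\<close>)
    then show ?thesis using pos by (simp add: field_simps)
  qed
  define B where "B = A - l \<cdot>\<^sub>m 1\<^sub>m n"
  have B: "B \<in> carrier_mat n n" "B\<^sup>T = B"
    using A symmetric_shifted_mat[OF A sym] by (auto simp: B_def intro!: minus_carrier_mat)
  have psd: "0 \<le> x \<bullet> (B *\<^sub>v x)" if "x \<in> carrier_vec n" for x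
    using l[OF that] by (simp add: B_def shifted_mat_form(2)[OF A that])
  have "det B = 0"
  proof (rule ccontr)
    assume "det B \<noteq> 0"
    then obtain C where C: "C \<in> carrier_mat n n" "C * B = 1\<^sub>m n"
      using det_non_zero_imp_unit[OF B(1), of undefined]
      by (auto simp: Units_def ring_mat_def)
    obtain M where M: "M > 0"
      "\<And>x. x \<in> carrier_vec n \<Longrightarrow> (C *\<^sub>v x) \<bullet> (C *\<^sub>v x) \<le> M * (x \<bullet> x)"
      using mult_mat_vec_norm_bound[OF C(1)] by blast
    obtain N where N: "N > 0"
      "\<And>x. x \<in> carrier_vec n \<Longrightarrow> (B *\<^sub>v x) \<bullet> (B *\<^sub>v x) \<le> N * (x \<bullet> (B *\<^sub>v x))"
      using psd_mult_mat_vec_bound[OF B psd] by blast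
    \<comment> \<open>Invertibility gives |x|^2 \<le> M |B x|^2, and semidefiniteness bounds |B x|^2
      by \<open>N\<close> times the form, so the form of \<open>B\<close> is at least |x|^2 / (M
      N).\<close>
    have "l + 1 / (M * N) \<in> S" unfolding S_def
    proof (intro CollectI ballI)
      fix x :: "real vec" assume x: "x \<in> carrier_vec n"
      have Bx: "B *\<^sub>v x \<in> carrier_vec n" using B x by simp
      have "x = C *\<^sub>v (B *\<^sub>v x)"
        using B C x by (metis assoc_mult_mat_vec one_mult_mat_vec)
      then have "x \<bullet> x \<le> M * ((B *\<^sub>v x) \<bullet> (B *\<^sub>v x))"
        using M(2)[OF Bx] by simp
      also have "\<dots> \<le> M * (N * (x \<bullet> (B *\<^sub>v x)))"
        using M(1) N(2)[OF x] by simp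
      finally have "1 / (M * N) * (x \<bullet> x) \<le> x \<bullet> (B *\<^sub>v x)"
        using M(1) N(1) by (simp add: field_simps)
      then show "(l + 1 / (M * N)) * (x \<bullet> x) \<le> x \<bullet> (A *\<^sub>v x)"
        by (simp add: B_def shifted_mat_form(2)[OF A x] algebra_simps)
    qed
    then have "l + 1 / (M * N) \<le> l" unfolding l_def by (rule cSup_upper[OF _ bdd])
    moreover have "1 / (M * N) > 0" using M(1) N(1) by simp
    ultimately show False by linarith
  qed
  then obtain v where v: "v \<in> carrier_vec n" "v \<noteq> 0\<^sub>v n" "B *\<^sub>v v = 0\<^sub>v n"
    using det_0_iff_vec_prod_zero_field[OF B(1)] by blast
  have "A *\<^sub>v v = l \<cdot>\<^sub>v v"
  proof (rule eq_vecI)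
    fix i assume "i < dim_vec (l \<cdot>\<^sub>v v)"
    moreover have "(A *\<^sub>v v - l \<cdot>\<^sub>v v) $ i = 0\<^sub>v n $ i"
      using v(3) by (simp add: B_def shifted_mat_form[OF A v(1)])
    ultimately show "(A *\<^sub>v v) $ i = (l \<cdot>\<^sub>v v) $ i" using A v(1) by simp
  qed (use A v in auto)
  then have "eigenvalue A l"
    using A v by (auto simp: eigenvalue_def eigenvector_def)
  then have "\<mu> \<le> l" by (rule ev)
  then have "\<mu> * (x \<bullet> x) \<le> l * (x \<bullet> x)"
    using scalar_prod_self_nonneg[OF x] by (rule mult_right_mono)
  then show ?thesis using l[OF x] by linarith
qed

text \<open>For a positive semidefinite matrix, |B x|^2 is at most a multiple of the form at
  \<open>x\<close>, so a vanishing form forces \<open>B x = 0\<close>. This is how tightness of an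
  inequality becomes an eigenvector equation.\<close>

lemma symmetric_form_lower_bound_eqD:
  fixes A :: "real mat"
  assumes A: "A \<in> carrier_mat n n" and sym: "A\<^sup>T = A"
    and ev: "\<And>l. eigenvalue A l \<Longrightarrow> \<mu> \<le> l"
    and x: "x \<in> carrier_vec n" and eq: "x \<bullet> (A *\<^sub>v x) = \<mu> * (x \<bullet> x)"
  shows "A *\<^sub>v x = \<mu> \<cdot>\<^sub>v x"
proof -
  define B where "B = A - \<mu> \<cdot>\<^sub>m 1\<^sub>m n"
  have B: "B \<in> carrier_mat n n" "B\<^sup>T = B"
    using A symmetric_shifted_mat[OF A sym] by (auto simp: B_def intro!: minus_carrier_mat)
  have psd: "0 \<le> y \<bullet> (B *\<^sub>v y)" if "y \<in> carrier_vec n" for y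
    using symmetric_form_lower_bound[OF A sym ev that]
    by (simp add: B_def shifted_mat_form(2)[OF A that])
  obtain N where N: "N > 0"
    "\<And>x. x \<in> carrier_vec n \<Longrightarrow> (B *\<^sub>v x) \<bullet> (B *\<^sub>v x) \<le> N * (x \<bullet> (B *\<^sub>v x))"
    using psd_mult_mat_vec_bound[OF B psd] by blast
  have Bx: "B *\<^sub>v x \<in> carrier_vec n" using B x by simp
  have "x \<bullet> (B *\<^sub>v x) = 0" using eq by (simp add: B_def shifted_mat_form(2)[OF A x])
  then have "(B *\<^sub>v x) \<bullet> (B *\<^sub>v x) = 0"
    using N(2)[OF x] scalar_prod_self_nonneg[OF Bx] by simp
  then have "A *\<^sub>v x - \<mu> \<cdot>\<^sub>v x = 0\<^sub>v n"
    using scalar_prod_self_eq_0D[OF Bx] by (simp add: B_def shifted_mat_form[OF A x])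
  then have *: "(A *\<^sub>v x - \<mu> \<cdot>\<^sub>v x) $ i = 0" if "i < n" for i using that by simp
  show ?thesis
  proof (rule eq_vecI)
    fix i assume "i < dim_vec (\<mu> \<cdot>\<^sub>v x)"
    then show "(A *\<^sub>v x) $ i = (\<mu> \<cdot>\<^sub>v x) $ i" using *[of i] A x by simp
  qed (use A x in auto)
qed

section \<open>Edge colourings of complete and regular bipartite graphs\<close>

text \<open>Hall's theorem by the Halmos-Vaughan induction. If some proper nonempty \<open>J\<close>
  is tight, match \<open>J\<close> on its own and the rest outside the values available to
  \<open>J\<close>; Hall's condition for a set \<open>K\<close> of the rest follows from that for
  \<open>K \<union> J\<close>. If none is tight, every proper nonempty subset has a spare value, so
  one arbitrary choice can be fixed and removed.\<close>

lemma hall_system_of_representatives: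
  fixes A :: "'a \<Rightarrow> 'b set"
  assumes "finite X"
    and "\<And>x. x \<in> X \<Longrightarrow> finite (A x)"
    and "\<And>J. J \<subseteq> X \<Longrightarrow> card J \<le> card (\<Union>(A ` J))"
  shows "\<exists>f. inj_on f X \<and> (\<forall>x\<in>X. f x \<in> A x)"
  using assms
proof (induction X arbitrary: A rule: finite_psubset_induct)
  case (psubset X)
  note fin = psubset.prems(1) and hall = psubset.prems(2)
  have finU: "finite (\<Union>(A ` J))" if "J \<subseteq> X" for J
    using that fin psubset.hyps by (blast intro: finite_subset)
  consider "X = {}"
    | J where "J \<subset> X" "J \<noteq> {}" "card (\<Union>(A ` J)) = card J"
    | "X \<noteq> {}" "\<And>J. J \<subset> X \<Longrightarrow> J \<noteq> {} \<Longrightarrow> card J < card (\<Union>(A ` J))"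
    using hall by (metis le_neq_implies_less psubset_imp_subset)
  then show ?case
  proof cases
    case 1
    then show ?thesis by simp
  next
    case (2 J)
    then have J: "J \<subseteq> X" and finJ: "finite J" using psubset.hyps finite_subset by blast+
    have "\<exists>f. inj_on f J \<and> (\<forall>x\<in>J. f x \<in> A x)"
      using 2(1) J fin hall by (intro psubset.IH) auto
    then obtain f where f: "inj_on f J" "\<forall>x\<in>J. f x \<in> A x" by blast
    let ?U = "\<Union>(A ` J)"
    let ?B = "\<lambda>x. A x - ?U"
    have "\<exists>g. inj_on g (X - J) \<and> (\<forall>x\<in>X - J. g x \<in> ?B x)"
    proof (rule psubset.IH)
      show "X - J \<subset> X" using 2 by blast
      show "finite (?B x)" if "x \<in> X - J" for x using that fin by auto
      fix K assume K: "K \<subseteq> X - J"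
      then have "finite K" using psubset.hyps finite_subset by blast
      have "card K + card J = card (K \<union> J)"
        using K finJ \<open>finite K\<close> by (subst card_Un_disjoint) auto
      also have "\<dots> \<le> card (\<Union>(A ` (K \<union> J)))" using K J by (intro hall) auto
      also have "\<Union>(A ` (K \<union> J)) = \<Union>(?B ` K) \<union> ?U" by auto
      also have "card \<dots> = card (\<Union>(?B ` K)) + card ?U"
        using K finU[OF J] finU[of K]
        by (intro card_Un_disjoint) (auto intro: finite_subset[of _ "\<Union>(A ` K)"])
      finally show "card K \<le> card (\<Union>(?B ` K))" using 2 by simp
    qed
    then obtain g where g: "inj_on g (X - J)" "\<forall>x\<in>X - J. g x \<in> ?B x" by blast
    let ?h = "\<lambda>x. if x \<in> J then f x else g x"
    have "inj_on ?h X"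
    proof (rule inj_onI)
      fix x y assume xy: "x \<in> X" "y \<in> X" "?h x = ?h y"
      have "f a \<noteq> g b" if "a \<in> J" "b \<in> X - J" for a b using that f g by fastforce
      then show "x = y" using xy f(1) g(1)
        by (auto simp: inj_on_def split: if_splits) (metis DiffI)+
    qed
    moreover have "\<forall>x\<in>X. ?h x \<in> A x" using f g by auto
    ultimately show ?thesis by blast
  next
    case 3
    then obtain x0 where x0: "x0 \<in> X" by blast
    have "card {x0} \<le> card (\<Union>(A ` {x0}))" using x0 by (intro hall) auto
    then have "A x0 \<noteq> {}" by auto
    then obtain y0 where y0: "y0 \<in> A x0" by blast
    let ?B = "\<lambda>x. A x - {y0}"
    have "\<exists>g. inj_on g (X - {x0}) \<and> (\<forall>x\<in>X - {x0}. g x \<in> ?B x)"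
    proof (rule psubset.IH)
      show "X - {x0} \<subset> X" using x0 by blast
      show "finite (?B x)" if "x \<in> X - {x0}" for x using that fin by auto
      fix K assume K: "K \<subseteq> X - {x0}"
      show "card K \<le> card (\<Union>(?B ` K))"
      proof (cases "K = {}")
        case False
        then have "card K < card (\<Union>(A ` K))" using K x0 by (intro 3) auto
        also have "\<Union>(?B ` K) = \<Union>(A ` K) - {y0}" by auto
        then have "card (\<Union>(A ` K)) \<le> Suc (card (\<Union>(?B ` K)))"
          by (simp only: card_Diff_singleton_if split: if_split) arith
        finally show ?thesis by simp
      qed simp
    qed
    then obtain g where g: "inj_on g (X - {x0})" "\<forall>x\<in>X - {x0}. g x \<in> ?B x" by blast
    then have "inj_on (g(x0 := y0)) X" using x0
      by (auto simp: inj_on_def)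
    moreover have "\<forall>x\<in>X. (g(x0 := y0)) x \<in> A x" using g y0 by auto
    ultimately show ?thesis by blast
  qed
qed

section \<open>Bounding, gluing and lifting edge colourings\<close>

abbreviation edge_colourable :: "'a set set \<Rightarrow> nat \<Rightarrow> bool" where
  "edge_colourable E m \<equiv> \<exists>c. proper_edge_colouring E m c"

definition neighbours :: "'a set set \<Rightarrow> 'a \<Rightarrow> 'a set" where
  "neighbours E v = {u. {v, u} \<in> E}"

definition edges_between :: "'a set \<Rightarrow> 'a set \<Rightarrow> 'a set set" where
  "edges_between X Y = {{x, y} |x y. x \<in> X \<and> y \<in> Y}"

lemma all_edgesI: "u \<in> V \<Longrightarrow> v \<in> V \<Longrightarrow> u \<noteq> v \<Longrightarrow> {u, v} \<in> all_edges V"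
  by (simp add: all_edges_def)

lemma all_edgesE:
  assumes "e \<in> all_edges V"
  obtains u v where "e = {u, v}" "u \<noteq> v" "u \<in> V" "v \<in> V"
  using assms by (auto simp: all_edges_def card_2_iff)

lemma all_edges_obtain_other:
  assumes "e \<in> all_edges V" "u \<in> e"
  obtains v where "e = {u, v}" "u \<noteq> v" "u \<in> V" "v \<in> V"
  using assms by (elim all_edgesE) (auto simp: insert_commute)

lemma doubleton_in_all_edges_iff: "{u, v} \<in> all_edges V \<longleftrightarrow> u \<in> V \<and> v \<in> V \<and> u \<noteq> v"
  by (auto simp: all_edges_def card_2_iff doubleton_eq_iff)

lemma finite_all_edges: "finite V \<Longrightarrow> finite (all_edges V)"
  by (rule finite_subset[of _ "Pow V"]) (auto simp: all_edges_def)

lemma vertex_degree_eq_card_neighbours: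
  assumes "E \<subseteq> all_edges V"
  shows "vertex_degree E v = card (neighbours E v)"
proof -
  have "bij_betw (\<lambda>u. {v, u}) (neighbours E v) {e \<in> E. v \<in> e}"
    unfolding bij_betw_def
  proof
    show "inj_on (\<lambda>u. {v, u}) (neighbours E v)"
      by (auto simp: inj_on_def doubleton_eq_iff)
    show "(\<lambda>u. {v, u}) ` neighbours E v = {e \<in> E. v \<in> e}"
    proof (intro equalityI subsetI)
      fix e assume "e \<in> {e \<in> E. v \<in> e}"
      moreover from this obtain u where "e = {v, u}"
        using assms by (blast elim: all_edges_obtain_other)
      ultimately show "e \<in> (\<lambda>u. {v, u}) ` neighbours E v" by (auto simp: neighbours_def)
    qed (auto simp: neighbours_def)
  qed
  then show ?thesis by (simp add: vertex_degree_def bij_betw_same_card)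
qed

lemma neighbours_subset:
  assumes "E \<subseteq> all_edges V"
  shows "neighbours E v \<subseteq> V - {v}"
proof
  fix u assume "u \<in> neighbours E v"
  then have "{v, u} \<in> all_edges V" using assms by (auto simp: neighbours_def)
  then show "u \<in> V - {v}" unfolding doubleton_in_all_edges_iff by auto
qed

lemma proper_edge_colouring_ge_degree:
  assumes "proper_edge_colouring E m c"
  shows "vertex_degree E v \<le> m"
proof -
  have "inj_on c {e \<in> E. v \<in> e}"
    using assms by (fastforce simp: proper_edge_colouring_def inj_on_def)
  moreover have "c ` {e \<in> E. v \<in> e} \<subseteq> {..<m}"
    using assms by (auto simp: proper_edge_colouring_def)
  ultimately have "card {e \<in> E. v \<in> e} \<le> card {..<m}"
    by (intro card_inj_on_le) auto
  then show ?thesis by (simp add: vertex_degree_def)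
qed

text \<open>The edges at one vertex already need \<open>k\<close> colours, so only a colouring with
  \<open>k\<close> colours remains to be constructed. \<open>V \<noteq> {}\<close> supplies that
  vertex and keeps \<open>Max\<close> meaningful.\<close>

lemma regular_class_1I:
  assumes "V \<noteq> {}" "regular V E k" "edge_colourable E k"
  shows "class_1 V E"
proof -
  have "vertex_degree E ` V = {k}" using assms by (auto simp: regular_def)
  then have "max_degree V E = k" by (simp add: max_degree_def)
  moreover have "chromatic_index E = k" unfolding chromatic_index_def
  proof (rule Least_equality)
    obtain v where "v \<in> V" using assms(1) by blast
    then show "k \<le> m" if "edge_colourable E m" for m
      using that assms(2) proper_edge_colouring_ge_degree unfolding regular_def by metis
  qed fact
  ultimately show ?thesis by (simp add: class_1_def)
qed

lemma edge_colourable_Un: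
  assumes "edge_colourable E a" "edge_colourable F b"
  shows "edge_colourable (E \<union> F) (a + b)"
proof -
  obtain c d where "proper_edge_colouring E a c" "proper_edge_colouring F b d"
    using assms by blast
  note cd = this[unfolded proper_edge_colouring_def]
  have "proper_edge_colouring (E \<union> F) (a + b) (\<lambda>e. if e \<in> E then c e else a + d e)"
    unfolding proper_edge_colouring_def
  proof (intro conjI ballI impI)
    fix e assume "e \<in> E \<union> F"
    then show "(if e \<in> E then c e else a + d e) < a + b" using cd by (auto simp: trans_less_add1)
  next
    fix e f assume "e \<in> E \<union> F" "f \<in> E \<union> F" "e \<noteq> f \<and> e \<inter> f \<noteq> {}"
    moreover have "c g < a" if "g \<in> E" for g using cd that by blast
    then have "c g \<noteq> a + k" if "g \<in> E" for g k using that by fastforce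
    moreover from this have "a + k \<noteq> c g" if "g \<in> E" for g k using that by metis
    ultimately show "(if e \<in> E then c e else a + d e) \<noteq> (if f \<in> E then c f else a + d f)"
      using cd by (cases "e \<in> E"; cases "f \<in> E") (simp; fail)+
  qed
  then show ?thesis by blast
qed

lemma edge_colourable_subset:
  assumes "edge_colourable E m" "F \<subseteq> E"
  shows "edge_colourable F m"
proof -
  obtain c where c: "proper_edge_colouring E m c" using assms(1) by blast
  then have "proper_edge_colouring F m c"
    using assms(2) unfolding proper_edge_colouring_def by (meson subsetD)
  then show ?thesis by blast
qed

text \<open>Product colouring: the colour of the image under \<open>h\<close> and the colour inside
  the fibre are written as two digits to base \<open>d\<close>. Adjacent edges have intersecting
  images, so equal leading digits put them into one fibre, where the second digit separates
  them.\<close>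

lemma edge_colourable_quotient:
  fixes F :: "'a set set" and Q :: "'b set set"
  assumes h: "\<And>e. e \<in> F \<Longrightarrow> h e \<in> Q"
    and meet: "\<And>e f. e \<in> F \<Longrightarrow> f \<in> F \<Longrightarrow> e \<inter> f \<noteq> {} \<Longrightarrow> h e \<inter> h f \<noteq> {}"
    and Q: "edge_colourable Q q"
    and fibre: "\<And>g. g \<in> Q \<Longrightarrow> edge_colourable {e \<in> F. h e = g} d"
  shows "edge_colourable F (q * d)"
proof -
  obtain r where r: "proper_edge_colouring Q q r" using Q by blast
  obtain col where col: "\<And>g. g \<in> Q \<Longrightarrow> proper_edge_colouring {e \<in> F. h e = g} d (col g)"
    using fibre by metis
  have r_less: "r (h e) < q" and col_less: "col (h e) e < d" if "e \<in> F" for e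
    using r col[OF h[OF that]] h[OF that] that by (auto simp: proper_edge_colouring_def)
  let ?c = "\<lambda>e. r (h e) * d + col (h e) e"
  have "proper_edge_colouring F (q * d) ?c"
    unfolding proper_edge_colouring_def
  proof (intro conjI ballI impI)
    fix e assume e: "e \<in> F"
    have "?c e < (r (h e) + 1) * d" using col_less[OF e] by simp
    also have "\<dots> \<le> q * d" using r_less[OF e] by (intro mult_right_mono) auto
    finally show "?c e < q * d" .
  next
    fix e f assume e: "e \<in> F" and f: "f \<in> F" and ne: "e \<noteq> f \<and> e \<inter> f \<noteq> {}"
    show "?c e \<noteq> ?c f"
    proof
      assume eq: "?c e = ?c f"
      have "r (h e) = ?c e div d" "r (h f) = ?c f div d"
        using col_less[OF e] col_less[OF f] by (auto simp: div_add1_eq)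
      then have r_eq: "r (h e) = r (h f)" using eq by simp
      then have "h e = h f"
        using r h e f ne meet[OF e f] unfolding proper_edge_colouring_def by blast
      moreover from this have "col (h e) e = col (h e) f" using eq r_eq by simp
      ultimately show False
        using col[OF h[OF e]] e f ne unfolding proper_edge_colouring_def by auto
    qed
  qed
  then show ?thesis by blast
qed

section \<open>Colouring by label sums\<close>

lemma add_mod_left_inj:
  fixes a x y m :: nat
  assumes "(a + x) mod m = (a + y) mod m" "x < m" "y < m"
  shows "x = y"
proof -
  have "x = y" if "(a + x) mod m = (a + y) mod m" "x \<le> y" "y < m" for x y
  proof -
    have "m dvd y - x" using that mod_eq_dvd_iff_nat[of "a + x" "a + y" m] by simp
    then show ?thesis using that by (cases "x = y") (auto dest: dvd_imp_le)
  qed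
  then show ?thesis using assms by (metis nat_le_linear)
qed

text \<open>Two is invertible modulo an odd number. In the round-robin colouring this separates the
  edges at the distinguished vertex, whose colours are doubled labels.\<close>

lemma double_mod_odd_inj:
  fixes x y m :: nat
  assumes "(2 * x) mod m = (2 * y) mod m" "x < m" "y < m" "odd m"
  shows "x = y"
proof -
  have "x = y" if "(2 * x) mod m = (2 * y) mod m" "x \<le> y" "y < m" for x y
  proof -
    have "m dvd 2 * (y - x)"
      using that mod_eq_dvd_iff_nat[of "2 * x" "2 * y" m] by (simp add: diff_mult_distrib2)
    then have "m dvd y - x" using assms(4)
      by (metis coprime_commute coprime_dvd_mult_right_iff coprime_left_2_iff_odd)
    then show ?thesis using that by (cases "x = y") (auto dest: dvd_imp_le)
  qed
  then show ?thesis using assms by (metis nat_le_linear)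
qed

text \<open>Colour each edge by the sum of its end labels modulo $m$.\<close>

lemma edge_colourable_by_labels:
  fixes h :: "'a \<Rightarrow> nat"
  assumes F: "F \<subseteq> all_edges V"
    and h: "\<And>v. v \<in> V \<Longrightarrow> h v < m"
    and ne: "\<And>u v w. {u, v} \<in> F \<Longrightarrow> {u, w} \<in> F \<Longrightarrow> v \<noteq> w \<Longrightarrow> h v \<noteq> h w"
  shows "edge_colourable F m"
proof -
  have "proper_edge_colouring F m (\<lambda>e. (\<Sum>v\<in>e. h v) mod m)"
    unfolding proper_edge_colouring_def
  proof (intro conjI ballI impI)
    fix e assume "e \<in> F"
    then obtain u where "u \<in> V" using F by (blast elim: all_edgesE)
    then have "m > 0" using h by fastforce
    then show "(\<Sum>v\<in>e. h v) mod m < m" by simp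
  next
    fix e f assume e: "e \<in> F" and f: "f \<in> F" and ef: "e \<noteq> f \<and> e \<inter> f \<noteq> {}"
    then obtain u where "u \<in> e" "u \<in> f" by blast
    with e f F obtain v w where v: "e = {u, v}" "u \<noteq> v" "v \<in> V" and w: "f = {u, w}" "u \<noteq> w" "w \<in> V"
      by (meson all_edges_obtain_other subsetD)
    then have "h v \<noteq> h w" using ne e f ef by blast
    then show "(\<Sum>v\<in>e. h v) mod m \<noteq> (\<Sum>v\<in>f. h v) mod m"
      using v w h add_mod_left_inj[of "h u" "h v" m "h w"] by auto
  qed
  then show ?thesis by blast
qed

text \<open>Round-robin tournament: a distinguished vertex $z$ meets $v$ in the round that the
  sum colouring modulo the odd number $|X| - 1$ leaves free at $v$.\<close>

lemma edge_colourable_complete_even: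
  assumes "finite X" "even (card X)"
  shows "edge_colourable (all_edges X) (card X - 1)"
proof (cases "X = {}")
  case True
  then have "all_edges X = {}" by (auto simp: all_edges_def)
  then show ?thesis by (auto simp: proper_edge_colouring_def)
next
  case False
  then obtain z where z: "z \<in> X" by blast
  define p where "p = card X - 1"
  have p: "odd p" "card (X - {z}) = p"
    using assms z False by (auto simp: p_def card_gt_0_iff)
  obtain g where g: "bij_betw g (X - {z}) {0..<p}"
    using ex_bij_betw_finite_nat[of "X - {z}"] assms p by auto
  \<comment> \<open>With label 0 at \<open>z\<close>, the label sum of the edge from
    \<open>z\<close> to \<open>x\<close> is \<open>h x\<close>, and the factor 2 turns it into
    \<open>h x + h x\<close>. No other edge at \<open>x\<close> has this colour, because its other
    end has a label different from \<open>h x\<close>.\<close>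
  define h where "h = g(z := 0)"
  have h_less: "h v < p" if "v \<in> X" for v
    using that g p(1) by (auto simp: h_def bij_betw_def odd_pos)
  have h_inj: "h u \<noteq> h v" if "u \<in> X - {z}" "v \<in> X - {z}" "u \<noteq> v" for u v
    using that g by (auto simp: h_def bij_betw_def inj_on_def)
  have hz: "h z = 0" by (simp add: h_def)
  let ?c = "\<lambda>e. ((if z \<in> e then 2 else 1) * (\<Sum>v\<in>e. h v)) mod p"
  have "proper_edge_colouring (all_edges X) p ?c"
    unfolding proper_edge_colouring_def
  proof (intro conjI ballI impI)
    fix e show "?c e < p" using p(1) by (simp add: odd_pos)
  next
    fix e f assume e: "e \<in> all_edges X" and f: "f \<in> all_edges X" and ef: "e \<noteq> f \<and> e \<inter> f \<noteq> {}"
    then obtain u where "u \<in> e" "u \<in> f" by blast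
    with e f obtain v w where v: "e = {u, v}" "u \<noteq> v" "v \<in> X" and w: "f = {u, w}" "u \<noteq> w" "w \<in> X"
      and u: "u \<in> X"
      by (metis all_edges_obtain_other)
    have vw: "v \<noteq> w" using ef v w by blast
    have c: "(if z \<in> {u, x} then 2 else 1) * (\<Sum>v\<in>{u, x}. h v) =
        (if u = z then 2 * h x else if x = z then h u + h u else h u + h x)" if "u \<noteq> x" for x
      using that hz by auto
    note ce = c[OF v(2), folded v(1)] and cf = c[OF w(2), folded w(1)]
    show "?c e \<noteq> ?c f"
    proof (cases "u = z")
      case True
      then show ?thesis unfolding ce cf
        using double_mod_odd_inj[of "h v" p "h w"] h_less v w vw h_inj[of v w] p(1) by auto
    next
      case False
      then show ?thesis unfolding ce cf
        using add_mod_left_inj[of "h u" "h v" p "h w"] add_mod_left_inj[of "h u" "h u" p "h w"]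
          add_mod_left_inj[of "h u" "h v" p "h u"] h_less u v w vw
          h_inj[of v w] h_inj[of u w] h_inj[of u v] by auto
    qed
  qed
  then show ?thesis by (auto simp: p_def)
qed

section \<open>1-factorisation of regular bipartite graphs\<close>

lemma edges_between_commute: "edges_between X Y = edges_between Y X"
  by (auto simp: edges_between_def insert_commute)

lemma edges_between_subset_all_edges:
  "X \<inter> Y = {} \<Longrightarrow> edges_between X Y \<subseteq> all_edges (X \<union> Y)"
  by (auto simp: edges_between_def intro!: all_edgesI)

text \<open>An edge has only one end in \<open>X\<close>, so the stars of the vertices of
  \<open>K\<close> are disjoint.\<close>

lemma regular_bipartite_edge_count:
  assumes "finite X" "X \<inter> Y = {}" "H \<subseteq> edges_between X Y" "finite H"
    and "regular (X \<union> Y) H d" "K \<subseteq> X"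
  shows "card {e \<in> H. e \<inter> K \<noteq> {}} = card K * d"
proof -
  have "{e \<in> H. e \<inter> K \<noteq> {}} = (\<Union>x\<in>K. {e \<in> H. x \<in> e})" by auto
  also have "card \<dots> = (\<Sum>x\<in>K. card {e \<in> H. x \<in> e})"
  proof (rule card_UN_disjoint)
    show "\<forall>x\<in>K. \<forall>y\<in>K. x \<noteq> y \<longrightarrow> {e \<in> H. x \<in> e} \<inter> {e \<in> H. y \<in> e} = {}"
    proof (intro ballI impI equals0I)
      fix x y e assume *: "x \<in> K" "y \<in> K" "x \<noteq> y" "e \<in> {e \<in> H. x \<in> e} \<inter> {e \<in> H. y \<in> e}"
      then obtain a b where "e = {a, b}" "a \<in> X" "b \<in> Y"
        using assms(3) by (auto simp: edges_between_def)
      then show False using * assms(2,6) by auto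
    qed
  qed (use assms finite_subset in auto)
  also have "\<dots> = (\<Sum>x\<in>K. d)"
    using assms(5,6) by (intro sum.cong) (auto simp: regular_def vertex_degree_def)
  finally show ?thesis by simp
qed

text \<open>Hall's condition by counting: all edges at \<open>J\<close> end in its neighbourhood,
  and both sets have \<open>Suc d\<close> edges per vertex; this positive factor cancels. The same
  count on the whole sides gives equal cardinalities, so an injective choice of neighbours is a
  bijection.\<close>

lemma regular_bipartite_remove_perfect_matching:
  assumes fin: "finite X" "finite Y" and disj: "X \<inter> Y = {}"
    and H: "H \<subseteq> edges_between X Y" and reg: "regular (X \<union> Y) H (Suc d)"
  obtains f where "bij_betw f X Y" "(\<lambda>x. {x, f x}) ` X \<subseteq> H"
    "regular (X \<union> Y) (H - (\<lambda>x. {x, f x}) ` X) d"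
proof -
  have HV: "H \<subseteq> all_edges (X \<union> Y)"
    using H edges_between_subset_all_edges[OF disj] by blast
  then have finH: "finite H" using finite_all_edges[of "X \<union> Y"] fin finite_subset by blast
  have countX: "card {e \<in> H. e \<inter> K \<noteq> {}} = card K * Suc d" if "K \<subseteq> X" for K
    using regular_bipartite_edge_count[OF fin(1) disj H finH reg that] .
  have countY: "card {e \<in> H. e \<inter> K \<noteq> {}} = card K * Suc d" if "K \<subseteq> Y" for K
    using regular_bipartite_edge_count[of Y X H "Suc d" K] fin disj H finH reg that
    by (simp add: Int_commute Un_commute edges_between_commute)
  have nbr: "neighbours H x \<subseteq> Y" if "x \<in> X" for x
    using that H disj by (fastforce simp: neighbours_def edges_between_def doubleton_eq_iff)
  have "\<exists>f. inj_on f X \<and> (\<forall>x\<in>X. f x \<in> neighbours H x)"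
  proof (rule hall_system_of_representatives[OF fin(1)])
    show "finite (neighbours H x)" if "x \<in> X" for x
      using nbr[OF that] fin(2) finite_subset by blast
    fix J assume J: "J \<subseteq> X"
    let ?N = "\<Union>(neighbours H ` J)"
    have N: "?N \<subseteq> Y" using nbr J by blast
    have "{e \<in> H. e \<inter> J \<noteq> {}} \<subseteq> {e \<in> H. e \<inter> ?N \<noteq> {}}"
    proof
      fix e assume "e \<in> {e \<in> H. e \<inter> J \<noteq> {}}"
      then obtain u where u: "e \<in> H" "u \<in> e" "u \<in> J" by blast
      then obtain v where "e = {u, v}" using HV by (meson all_edges_obtain_other subsetD)
      then show "e \<in> {e \<in> H. e \<inter> ?N \<noteq> {}}" using u by (auto simp: neighbours_def)
    qed
    then have "card {e \<in> H. e \<inter> J \<noteq> {}} \<le> card {e \<in> H. e \<inter> ?N \<noteq> {}}"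
      using finH by (intro card_mono) auto
    then show "card J \<le> card ?N"
      unfolding countX[OF J] countY[OF N] by (simp only: mult_le_cancel2)
  qed
  then obtain f where f: "inj_on f X" "\<And>x. x \<in> X \<Longrightarrow> {x, f x} \<in> H"
    by (auto simp: neighbours_def)
  have fY: "f ` X \<subseteq> Y" using f(2) nbr by (auto simp: neighbours_def)
  have "{e \<in> H. e \<inter> X \<noteq> {}} = {e \<in> H. e \<inter> Y \<noteq> {}}"
    using H by (fastforce simp: edges_between_def)
  then have "card X = card Y" using countX[of X] countY[of Y]
    by (metis mult_cancel2 nat.distinct(1) subset_refl)
  then have bij: "bij_betw f X Y"
    using f(1) fY fin by (simp add: bij_betw_def card_image card_subset_eq)
  let ?M = "(\<lambda>x. {x, f x}) ` X"
  have MH: "?M \<subseteq> H" using f(2) by blast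
  have M1: "card {e \<in> ?M. v \<in> e} = 1" if v: "v \<in> X \<union> Y" for v
  proof -
    obtain x where x: "x \<in> X" "v = x \<or> v = f x"
      using v bij by (auto simp: bij_betw_def)
    have "{e \<in> ?M. v \<in> e} = {{x, f x}}"
      using x fY disj f(1) by (fastforce simp: inj_on_def)
    then show ?thesis by simp
  qed
  have "regular (X \<union> Y) (H - ?M) d" unfolding regular_def
  proof
    fix v assume v: "v \<in> X \<union> Y"
    have "{e \<in> H - ?M. v \<in> e} = {e \<in> H. v \<in> e} - {e \<in> ?M. v \<in> e}" by blast
    then have "card {e \<in> H - ?M. v \<in> e} = card {e \<in> H. v \<in> e} - card {e \<in> ?M. v \<in> e}"
      using MH finH fin by (simp only:, intro card_Diff_subset) auto
    then show "vertex_degree (H - ?M) v = d"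
      using v reg M1[OF v] by (simp add: vertex_degree_def regular_def)
  qed
  then show thesis using that bij MH by blast
qed

lemma edge_colourable_perfect_matching:
  assumes "bij_betw f X Y" "X \<inter> Y = {}"
  shows "edge_colourable ((\<lambda>x. {x, f x}) ` X) 1"
proof -
  have "proper_edge_colouring ((\<lambda>x. {x, f x}) ` X) 1 (\<lambda>_. 0)"
    unfolding proper_edge_colouring_def
  proof (intro conjI ballI impI)
    fix e g assume *: "e \<in> (\<lambda>x. {x, f x}) ` X" "g \<in> (\<lambda>x. {x, f x}) ` X" "e \<noteq> g \<and> e \<inter> g \<noteq> {}"
    then obtain x y where "e = {x, f x}" "g = {y, f y}" "x \<in> X" "y \<in> X" by (elim conjE imageE)
    moreover from this have "x \<noteq> y" using * by auto
    ultimately have xy: "e = {x, f x}" "g = {y, f y}" "x \<in> X" "y \<in> X" "x \<noteq> y" .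
    then have "f x \<noteq> f y" "f x \<in> Y" "f y \<in> Y"
      using assms(1) by (auto simp: bij_betw_def inj_on_def)
    then show "0 \<noteq> 0" using * xy assms(2) by auto
  qed simp
  then show ?thesis by blast
qed

text \<open>Koenig's theorem in the regular case: each perfect matching removed costs one colour and
  lowers the degree by one.\<close>

lemma edge_colourable_regular_bipartite:
  assumes "finite X" "finite Y" "X \<inter> Y = {}" "H \<subseteq> edges_between X Y" "regular (X \<union> Y) H d"
  shows "edge_colourable H d"
  using assms(4,5)
proof (induction d arbitrary: H)
  case 0
  have "H = {}"
  proof (rule ccontr)
    assume "H \<noteq> {}"
    then obtain x y where xy: "{x, y} \<in> H" "x \<in> X" using 0 by (fastforce simp: edges_between_def)
    \<comment> \<open>Degrees are cardinalities, and an infinite set also has cardinality 0;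
      finiteness is what makes degree 0 contradict the presence of an edge.\<close>
    have "finite (all_edges (X \<union> Y))" using assms(1,2) by (simp add: finite_all_edges)
    moreover have "H \<subseteq> all_edges (X \<union> Y)"
      using 0(1) edges_between_subset_all_edges[OF assms(3)] by (rule order_trans)
    ultimately have "finite H" by (rule finite_subset[rotated])
    then have "card {e \<in> H. x \<in> e} > 0" using xy by (auto simp: card_gt_0_iff)
    then show False using 0(2) xy by (auto simp: regular_def vertex_degree_def)
  qed
  then show ?case by (auto simp: proper_edge_colouring_def)
next
  case (Suc d)
  obtain f where f: "bij_betw f X Y" "(\<lambda>x. {x, f x}) ` X \<subseteq> H"
    "regular (X \<union> Y) (H - (\<lambda>x. {x, f x}) ` X) d"
    using regular_bipartite_remove_perfect_matching[OF assms(1-3) Suc.prems] .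
  have "edge_colourable (H - (\<lambda>x. {x, f x}) ` X) d"
    using Suc.IH[of "H - (\<lambda>x. {x, f x}) ` X"] f(3) Suc.prems(1) by blast
  then have "edge_colourable ((H - (\<lambda>x. {x, f x}) ` X) \<union> (\<lambda>x. {x, f x}) ` X) (d + 1)"
    using edge_colourable_perfect_matching[OF f(1) assms(3)] by (rule edge_colourable_Un)
  then show ?case using f(2) by (simp add: Un_absorb2)
qed

text \<open>For odd $|X|$, a perfect matching inside \<open>H\<close> is used to copy the labelling of \<open>X\<close> to \<open>Y\<close>;
  matched vertices then miss the same colour, which is given to their matching edge.\<close>

lemma edge_colourable_two_cliques_regular_bipartite:
  assumes fin: "finite X" "finite Y" and disj: "X \<inter> Y = {}" and card: "card X = card Y"
    and H: "H \<subseteq> edges_between X Y" "regular (X \<union> Y) H d"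
    and par: "even (card X) \<or> d \<noteq> 0"
  shows "edge_colourable (all_edges X \<union> all_edges Y \<union> H) (card X - 1 + d)"
proof (cases "even (card X)")
  case True
  let ?p = "card X - 1"
  obtain a b where a: "proper_edge_colouring (all_edges X) ?p a"
    and b: "proper_edge_colouring (all_edges Y) ?p b"
    using edge_colourable_complete_even fin card True by metis
  \<comment> \<open>The cliques share no vertex and can use one palette; the bipartite graph then
    gets \<open>d\<close> fresh colours.\<close>
  have "proper_edge_colouring (all_edges X \<union> all_edges Y) ?p (\<lambda>e. if e \<subseteq> X then a e else b e)"
  proof -
    have "\<not> e \<subseteq> X" if "e \<in> all_edges Y" for e using that disj by (blast elim: all_edgesE)
    moreover have "e \<subseteq> X" if "e \<in> all_edges X" for e using that by (simp add: all_edges_def)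
    moreover have "e \<inter> f = {}" if "e \<in> all_edges X" "f \<in> all_edges Y" for e f
      using that disj by (auto simp: all_edges_def)
    moreover have "f \<inter> e = {}" if "e \<in> all_edges X" "f \<in> all_edges Y" for e f
      using that disj by (auto simp: all_edges_def)
    ultimately show ?thesis using a b unfolding proper_edge_colouring_def
      by (simp only: ball_Un) simp
  qed
  then show ?thesis
    using edge_colourable_Un edge_colourable_regular_bipartite[OF fin disj H] by blast
next
  case False
  then obtain d' where d: "d = Suc d'" using par by (cases d) auto
  obtain f where f: "bij_betw f X Y" "(\<lambda>x. {x, f x}) ` X \<subseteq> H"
    "regular (X \<union> Y) (H - (\<lambda>x. {x, f x}) ` X) d'"
    using regular_bipartite_remove_perfect_matching[OF fin disj H(1) H(2)[unfolded d]] .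
  let ?M = "(\<lambda>x. {x, f x}) ` X"
  let ?F = "all_edges X \<union> all_edges Y \<union> ?M"
  obtain g where g: "bij_betw g X {0..<card X}"
    using ex_bij_betw_finite_nat fin by blast
  define h where "h v = (if v \<in> X then g v else g (inv_into X f v))" for v
  have fY: "f x \<in> Y" if "x \<in> X" for x using f(1) that by (auto simp: bij_betw_def)
  have f_ne: "f x \<noteq> x" "x \<noteq> f x" if "x \<in> X" for x using fY[OF that] that disj by force+
  have hf: "h (f x) = h x" if "x \<in> X" for x
    using that fY[OF that] disj f(1) by (auto simp: h_def bij_betw_def)
  have h_inj: "x = y" if "x \<in> X" "y \<in> X" "h x = h y" for x y
    using that g by (auto simp: h_def bij_betw_def inj_on_def)
  have Y: "\<exists>x\<in>X. y = f x" if "y \<in> Y" for y using that f(1) by (auto simp: bij_betw_def)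
  \<comment> \<open>In \<open>?F\<close> a vertex is adjacent to the rest of its side and to its
    partner, which carries the vertex's own label. All labels around it are therefore
    different.\<close>
  have "edge_colourable ?F (card X)"
  proof (rule edge_colourable_by_labels[where h = h])
    show "?F \<subseteq> all_edges (X \<union> Y)"
      using fY f_ne by (auto simp: doubleton_in_all_edges_iff) (auto simp: all_edges_def)
    show "h v < card X" if "v \<in> X \<union> Y" for v
    proof -
      have "h x < card X" if "x \<in> X" for x using that g by (auto simp: h_def bij_betw_def)
      then show ?thesis using that Y hf by (metis UnE)
    qed
    have F: "u \<noteq> v \<and> (u \<in> X \<union> Y) \<and> (v \<in> X \<union> Y) \<and> (u \<in> X \<longrightarrow> v \<in> Y \<longrightarrow> v = f u) \<and> (v \<in> X \<longrightarrow> u \<in> Y \<longrightarrow> u = f v)"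
      if "{u, v} \<in> ?F" for u v
      using that disj fY f_ne by (auto simp: doubleton_in_all_edges_iff doubleton_eq_iff)
    fix u v w assume uv: "{u, v} \<in> ?F" and uw: "{u, w} \<in> ?F" and "v \<noteq> w"
    show "h v \<noteq> h w"
    proof
      assume eq: "h v = h w"
      \<comment> \<open>Equal labels on opposite sides mean partners. A common neighbour of the two
        equals \<open>a\<close> if it lies in \<open>X\<close> and \<open>b\<close> if it lies in
        \<open>Y\<close>, so it would be adjacent to itself.\<close>
      have *: False if "a \<in> X" "b \<in> Y" "h a = h b" "{u, a} \<in> ?F" "{u, b} \<in> ?F" for a b
      proof -
        have "b = f a" using that Y hf h_inj by metis
        then show False using F[OF that(4)] F[OF that(5)] that(1,2) h_inj hf by (metis UnE)
      qed
      have "v \<in> X \<union> Y" "w \<in> X \<union> Y" using F uv uw by blast+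
      then show False
        using * [of v w] *[of w v] eq uv uw \<open>v \<noteq> w\<close> h_inj Y hf by (metis UnE)
    qed
  qed
  moreover have "edge_colourable (H - ?M) d'"
    using edge_colourable_regular_bipartite[OF fin disj _ f(3)] H(1) by blast
  ultimately have "edge_colourable (?F \<union> (H - ?M)) (card X + d')"
    by (rule edge_colourable_Un)
  moreover have "?F \<union> (H - ?M) = all_edges X \<union> all_edges Y \<union> H" using f(2) by blast
  \<comment> \<open>The colour that the odd cliques cost in excess of their degree is the one saved
    by taking the matching out of \<open>H\<close>.\<close>
  moreover have "card X + d' = card X - 1 + d" using False d by (cases "card X") auto
  ultimately show ?thesis by simp
qed

section \<open>Equality in Hoffman's bound\<close>

lemma sum_neighbours_eq_sum:
  assumes "simple_graph V E"
  shows "(\<Sum>u\<in>neighbours E v. f u) = (\<Sum>u\<in>V. if {v, u} \<in> E then f u else (0 :: real))"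
proof -
  have "neighbours E v = {u \<in> V. {v, u} \<in> E}"
    using assms neighbours_subset[of E V v] by (auto simp: simple_graph_def neighbours_def)
  then show ?thesis using assms by (simp add: simple_graph_def sum.inter_filter)
qed

lemma sum_nth_eq_sum:
  assumes "distinct vs" "set vs = V"
  shows "(\<Sum>i<length vs. f (vs ! i)) = (\<Sum>v\<in>V. f v)"
  using assms by (intro sum.reindex_bij_betw bij_betw_nth) auto

lemma adj_matrix_symmetric: "(adj_matrix E vs)\<^sup>T = adj_matrix E vs"
  by (rule eq_matI) (auto simp: adj_matrix_def insert_commute)

lemma adj_matrix_mult_vec:
  assumes "simple_graph V E" "distinct vs" "set vs = V" "i < length vs"
  shows "(adj_matrix E vs *\<^sub>v vec (length vs) (\<lambda>i. f (vs ! i))) $ i = (\<Sum>u\<in>neighbours E (vs ! i). f u)"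
proof -
  have "(adj_matrix E vs *\<^sub>v vec (length vs) (\<lambda>i. f (vs ! i))) $ i =
      (\<Sum>j<length vs. if {vs ! i, vs ! j} \<in> E then f (vs ! j) else 0)"
    using assms(4) by (auto simp: adj_matrix_def scalar_prod_def atLeast0LessThan intro!: sum.cong)
  also have "\<dots> = (\<Sum>u\<in>V. if {vs ! i, u} \<in> E then f u else 0)"
    using sum_nth_eq_sum[OF assms(2,3), of "\<lambda>u. if {vs ! i, u} \<in> E then f u else 0"] .
  finally show ?thesis by (simp add: sum_neighbours_eq_sum[OF assms(1)])
qed

lemma eigenvalue_adj_matrix_iff:
  fixes n :: nat
  assumes "char_poly (adj_matrix E vs) = (\<Prod>i\<in>{1..n}. [:- \<theta> i, 1:])"
  shows "eigenvalue (adj_matrix E vs) l \<longleftrightarrow> (\<exists>i\<in>{1..n}. l = \<theta> i)"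
proof -
  have "adj_matrix E vs \<in> carrier_mat (length vs) (length vs)" by (simp add: adj_matrix_def)
  then have "eigenvalue (adj_matrix E vs) l \<longleftrightarrow> (\<Prod>i\<in>{1..n}. l - \<theta> i) = 0"
    using assms by (simp add: eigenvalue_root_char_poly poly_prod)
  then show ?thesis by (simp add: prod_zero_iff)
qed

text \<open>The eigenvalues are listed in nonincreasing order, so the last one is a lower bound for
  all and the results on symmetric forms apply to it. The enumeration of the vertices disappears
  here in favour of functions on \<open>V\<close>.\<close>

lemma least_adjacency_eigenvalue:
  assumes G: "simple_graph V E" and th: "adjacency_eigenvalues V E \<theta>"
  shows "\<theta> (card V) * (\<Sum>v\<in>V. (f v)\<^sup>2) \<le> (\<Sum>v\<in>V. f v * (\<Sum>u\<in>neighbours E v. f u))"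
    and "(\<Sum>v\<in>V. f v * (\<Sum>u\<in>neighbours E v. f u)) = \<theta> (card V) * (\<Sum>v\<in>V. (f v)\<^sup>2)
      \<Longrightarrow> v \<in> V \<Longrightarrow> (\<Sum>u\<in>neighbours E v. f u) = \<theta> (card V) * f v"
proof -
  obtain vs where vs: "distinct vs" "set vs = V"
    and cp: "char_poly (adj_matrix E vs) = (\<Prod>i\<in>{1..card V}. [:- \<theta> i, 1:])"
    and mono: "\<forall>i\<in>{1..card V}. \<forall>j\<in>{1..card V}. i \<le> j \<longrightarrow> \<theta> j \<le> \<theta> i"
    using th by (auto simp: adjacency_eigenvalues_def)
  let ?t = "\<theta> (card V)" and ?Q = "(\<Sum>v\<in>V. f v * (\<Sum>u\<in>neighbours E v. f u))" and ?N = "(\<Sum>v\<in>V. (f v)\<^sup>2)"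
  let ?n = "length vs" and ?A = "adj_matrix E vs"
  let ?x = "vec ?n (\<lambda>i. f (vs ! i))"
  have A: "?A \<in> carrier_mat ?n ?n" by (simp add: adj_matrix_def)
  have x: "?x \<in> carrier_vec ?n" by simp
  have ev: "?t \<le> l" if "eigenvalue ?A l" for l
    using that mono unfolding eigenvalue_adj_matrix_iff[OF cp] by auto
  have xx: "?x \<bullet> ?x = ?N"
    using sum_nth_eq_sum[OF vs, of "\<lambda>v. (f v)\<^sup>2"] by (simp add: scalar_prod_self[OF x])
  have "?x \<bullet> (?A *\<^sub>v ?x) = (\<Sum>i<?n. f (vs ! i) * (?A *\<^sub>v ?x) $ i)"
    using A unfolding scalar_prod_def by (intro sum.cong) auto
  also have "\<dots> = (\<Sum>i<?n. f (vs ! i) * (\<Sum>u\<in>neighbours E (vs ! i). f u))"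
    by (intro sum.cong) (simp_all add: adj_matrix_mult_vec[OF G vs] del: index_mult_mat_vec)
  also have "\<dots> = ?Q"
    using sum_nth_eq_sum[OF vs, of "\<lambda>v. f v * (\<Sum>u\<in>neighbours E v. f u)"] .
  finally have xAx: "?x \<bullet> (?A *\<^sub>v ?x) = ?Q" .
  show "?t * ?N \<le> ?Q"
    using symmetric_form_lower_bound[OF A adj_matrix_symmetric ev x] by (simp add: xx xAx)
  assume eq: "?Q = ?t * ?N" and v: "v \<in> V"
  have Ax: "?A *\<^sub>v ?x = ?t \<cdot>\<^sub>v ?x"
    using symmetric_form_lower_bound_eqD[OF A adj_matrix_symmetric ev x] eq by (simp add: xx xAx)
  obtain i where i: "i < ?n" "vs ! i = v" using v vs by (metis in_set_conv_nth)
  have "(\<Sum>u\<in>neighbours E v. f u) = (?A *\<^sub>v ?x) $ i"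
    using adj_matrix_mult_vec[OF G vs i(1)] i(2) by simp
  also have "\<dots> = ?t * f v" unfolding Ax using i by simp
  finally show "(\<Sum>u\<in>neighbours E v. f u) = ?t * f v" .
qed

text \<open>At a vertex where an eigenvector is largest in absolute value, the sum over its
  \<open>k\<close> neighbours is at most \<open>k\<close> times that value.\<close>

lemma largest_adjacency_eigenvalue_le_degree:
  assumes G: "simple_graph V E" and ne: "V \<noteq> {}" and reg: "regular V E k"
    and th: "adjacency_eigenvalues V E \<theta>"
  shows "\<theta> 1 \<le> real k"
proof -
  obtain vs where vs: "distinct vs" "set vs = V"
    and cp: "char_poly (adj_matrix E vs) = (\<Prod>i\<in>{1..card V}. [:- \<theta> i, 1:])"
    using th by (auto simp: adjacency_eigenvalues_def)
  let ?n = "length vs" and ?A = "adj_matrix E vs"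
  have finV: "finite V" using G by (simp add: simple_graph_def)
  then have "1 \<in> {1..card V}" using ne by (simp add: Suc_le_eq card_gt_0_iff)
  then have "eigenvalue ?A (\<theta> 1)" unfolding eigenvalue_adj_matrix_iff[OF cp] by blast
  then obtain x where x: "x \<in> carrier_vec ?n" "x \<noteq> 0\<^sub>v ?n" "?A *\<^sub>v x = \<theta> 1 \<cdot>\<^sub>v x"
    by (auto simp: eigenvalue_def eigenvector_def adj_matrix_def)
  obtain g where g: "\<And>i. i < ?n \<Longrightarrow> g (vs ! i) = i"
    using vs(1) by (metis nth_eq_iff_index_eq the_inv_into_f_f inj_on_nth lessThan_iff)
  define f where "f v = x $ g v" for v
  have xf: "x = vec ?n (\<lambda>i. f (vs ! i))" using x(1) g by (intro eq_vecI) (auto simp: f_def)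
  have eig: "(\<Sum>u\<in>neighbours E v. f u) = \<theta> 1 * f v" if v: "v \<in> V" for v
  proof -
    obtain i where i: "i < ?n" "vs ! i = v" using v vs by (metis in_set_conv_nth)
    have "(\<Sum>u\<in>neighbours E v. f u) = (?A *\<^sub>v x) $ i"
      using adj_matrix_mult_vec[OF G vs i(1), of f] i(2) xf by simp
    then show ?thesis unfolding x(3) using i x(1) g by (simp add: f_def) (metis g)
  qed
  obtain w where w: "w \<in> V" "\<And>v. v \<in> V \<Longrightarrow> \<bar>f v\<bar> \<le> \<bar>f w\<bar>"
  proof -
    have "Max ((\<lambda>v. \<bar>f v\<bar>) ` V) \<in> (\<lambda>v. \<bar>f v\<bar>) ` V" using finV ne by (intro Max_in) auto
    then obtain w where "w \<in> V" "\<bar>f w\<bar> = Max ((\<lambda>v. \<bar>f v\<bar>) ` V)" by force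
    then show thesis using that finV by (metis Max_ge finite_imageI imageI)
  qed
  have "f w \<noteq> 0"
  proof
    assume "f w = 0"
    then have "f v = 0" if "v \<in> V" for v using w(2)[OF that] by simp
    then have "x = 0\<^sub>v ?n" using vs by (subst xf, intro eq_vecI) auto
    then show False using x(2) by blast
  qed
  have EV: "E \<subseteq> all_edges V" using G by (simp add: simple_graph_def)
  have "\<theta> 1 * \<bar>f w\<bar> \<le> \<bar>\<theta> 1 * f w\<bar>" by (simp add: abs_mult mult_right_mono)
  also have "\<dots> = \<bar>\<Sum>u\<in>neighbours E w. f u\<bar>" using eig[OF w(1)] by simp
  also have "\<dots> \<le> (\<Sum>u\<in>neighbours E w. \<bar>f u\<bar>)" by (rule sum_abs)
  also have "\<dots> \<le> (\<Sum>u\<in>neighbours E w. \<bar>f w\<bar>)"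
    using w(2) neighbours_subset[OF EV] by (intro sum_mono) blast
  also have "\<dots> = real k * \<bar>f w\<bar>"
    using reg w(1) vertex_degree_eq_card_neighbours[OF EV] by (simp add: regular_def)
  finally show ?thesis using \<open>f w \<noteq> 0\<close> by simp
qed

text \<open>Equality in Hoffman's bound: each colour class \<open>S\<close> satisfies the ratio bound, obtained from
  the vector $1_S - |S|/n$; as the classes partition the vertex set, all these bounds are tight,
  and the vectors are eigenvectors for the least eigenvalue.\<close>

lemma hoffman_colouring_equitable:
  assumes G: "simple_graph V E" and ne: "V \<noteq> {}" and reg: "regular V E k"
    and th: "adjacency_eigenvalues V E \<theta>"
    and c: "proper_vertex_colouring V E m c" and m: "m \<ge> 2"
    and tight: "real m = 1 - \<theta> 1 / \<theta> (card V)"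
  obtains s t where "\<And>j. j < m \<Longrightarrow> card {v \<in> V. c v = j} = s"
    "\<And>v j. v \<in> V \<Longrightarrow> j < m \<Longrightarrow> c v \<noteq> j \<Longrightarrow> card {u \<in> neighbours E v. c u = j} = t"
proof -
  define n where "n = real (card V)"
  define l where "l = \<theta> (card V)"
  define d where "d v j = card {u \<in> neighbours E v. c u = j}" for v j
  define s where "s j = real (card {v \<in> V. c v = j})" for j
  have finV: "finite V" and EV: "E \<subseteq> all_edges V" using G by (auto simp: simple_graph_def)
  have NV: "neighbours E v \<subseteq> V" for v using neighbours_subset[OF EV] by blast
  have finN: "finite (neighbours E v)" for v using NV finV finite_subset by blast
  have cardN: "card (neighbours E v) = k" if "v \<in> V" for v
    using that reg vertex_degree_eq_card_neighbours[OF EV] by (simp add: regular_def)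
  have n: "n > 0" using finV ne by (simp add: n_def card_gt_0_iff)
  have cm: "c v < m" if "v \<in> V" for v using c that by (simp add: proper_vertex_colouring_def)
  have cN: "c u \<noteq> c v" if "v \<in> V" "u \<in> neighbours E v" for u v
    using c that NV by (fastforce simp: proper_vertex_colouring_def neighbours_def)
  have "l \<le> \<theta> 1"
    using th finV ne by (auto simp: adjacency_eigenvalues_def l_def Suc_le_eq card_gt_0_iff)
  \<comment> \<open>Division by zero yields 0, so \<open>l = 0\<close> would make \<open>m\<close>
    equal to 1.\<close>
  have "l \<noteq> 0" using tight m by (auto simp: l_def)
  then have ml: "l * real m = l - \<theta> 1" using tight by (simp add: l_def field_simps)
  have l: "l < 0"
  proof (rule ccontr)
    assume "\<not> l < 0"
    then have "l > 0" using \<open>l \<noteq> 0\<close> by simp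
    then have "l * real m \<ge> l * 2" using m by (intro mult_left_mono) auto
    then show False using ml \<open>l \<le> \<theta> 1\<close> \<open>l > 0\<close> by linarith
  qed
  have th1: "\<theta> 1 \<le> real k"
    by (rule largest_adjacency_eigenvalue_le_degree[OF G ne reg th])
  define a where "a j v = (if c v = j then 1 else 0 :: real)" for j v
  \<comment> \<open>Subtracting the mean removes the component along the all-ones vector, which by
    regularity is an eigenvector for \<open>k\<close>.\<close>
  define f where "f j v = a j v - s j / n" for j v
  have sum_a: "(\<Sum>v\<in>V. a j v) = s j" for j
    using finV by (simp add: a_def s_def flip: sum.inter_filter)
  have sum_aN: "(\<Sum>u\<in>neighbours E v. a j u) = d v j" for v j
    using finN by (simp add: a_def d_def flip: sum.inter_filter)
  have sum_fN: "(\<Sum>u\<in>neighbours E v. f j u) = d v j - k * s j / n" if "v \<in> V" for v j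
    using cardN[OF that] by (simp add: f_def sum_subtractf sum_aN)
  have sum_d: "(\<Sum>v\<in>V. real (d v j)) = k * s j" for j
  proof -
    have "(\<Sum>v\<in>V. real (d v j)) = (\<Sum>v\<in>V. \<Sum>u\<in>V. if {v, u} \<in> E then a j u else 0)"
      by (simp add: sum_neighbours_eq_sum[OF G, symmetric] sum_aN)
    also have "\<dots> = (\<Sum>u\<in>V. \<Sum>v\<in>V. if {u, v} \<in> E then a j u else 0)"
      by (subst sum.swap) (simp add: insert_commute)
    also have "\<dots> = (\<Sum>u\<in>V. k * a j u)"
      using cardN by (simp add: sum_neighbours_eq_sum[OF G, symmetric])
    finally show ?thesis by (simp add: sum_a flip: sum_distrib_left)
  qed
  have N: "(\<Sum>v\<in>V. (f j v)\<^sup>2) = s j - (s j)\<^sup>2 / n" for j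
  proof -
    have "(f j v)\<^sup>2 = a j v - 2 * (s j / n) * a j v + (s j / n)\<^sup>2" for v
      by (simp add: f_def a_def power2_eq_square algebra_simps)
    then have "(\<Sum>v\<in>V. (f j v)\<^sup>2) = s j - 2 * (s j / n) * s j + n * (s j / n)\<^sup>2"
      by (simp only: sum.distrib sum_subtractf sum_a sum_distrib_left[symmetric] sum_constant n_def)
    then show ?thesis using n by (simp add: field_simps power2_eq_square)
  qed
  have Q: "(\<Sum>v\<in>V. f j v * (\<Sum>u\<in>neighbours E v. f j u)) = - k * (s j)\<^sup>2 / n" for j
  proof -
    \<comment> \<open>Colour classes are independent, so the form of the plain indicator vanishes
      and only the terms coming from the mean survive.\<close>
    have "d v j = 0" if "v \<in> V" "c v = j" for v
      using cN[OF that(1)] that(2) finN by (auto simp: d_def)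
    then have "f j v * (d v j - k * s j / n)
        = (k * s j / n) * (s j / n) - (k * s j / n) * a j v - (s j / n) * d v j" if "v \<in> V" for v
      using that by (auto simp: f_def a_def algebra_simps)
    then have "(\<Sum>v\<in>V. f j v * (\<Sum>u\<in>neighbours E v. f j u)) =
        (\<Sum>v\<in>V. (k * s j / n) * (s j / n) - (k * s j / n) * a j v - (s j / n) * d v j)"
      by (intro sum.cong) (simp_all only: sum_fN)
    also have "\<dots> = n * ((k * s j / n) * (s j / n)) - (k * s j / n) * s j - (s j / n) * (k * s j)"
      by (simp only: sum_subtractf sum_distrib_left[symmetric] sum_a sum_d sum_constant n_def)
        (simp only: mult.left_commute)
    finally show ?thesis using n by (simp add: field_simps power2_eq_square)
  qed
  have s_nonneg: "s j \<ge> 0" for j by (simp add: s_def)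
  \<comment> \<open>The Rayleigh inequality for \<open>f j\<close>, multiplied by \<open>n\<close>
    and divided by \<open>s j\<close>, is Hoffman's ratio bound for an independent set.\<close>
  have ratio: "s j * (k - l) \<le> - l * n" for j
  proof (cases "s j = 0")
    case True
    then show ?thesis using l n by (simp add: mult_nonpos_nonneg)
  next
    case False
    then have pos: "s j > 0" using s_nonneg[of j] by linarith
    have "l * (s j - (s j)\<^sup>2 / n) \<le> - k * (s j)\<^sup>2 / n"
      using least_adjacency_eigenvalue(1)[OF G th, of "f j"] by (simp only: N Q l_def)
    then have "n * (l * (s j - (s j)\<^sup>2 / n)) \<le> n * (- k * (s j)\<^sup>2 / n)"
      using n by (intro mult_left_mono) auto
    moreover have "n * (l * (s j - (s j)\<^sup>2 / n)) = l * (n * s j - (s j)\<^sup>2)"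
      "n * (- k * (s j)\<^sup>2 / n) = - k * (s j)\<^sup>2"
      using n by (simp_all add: field_simps)
    ultimately have "s j * (s j * (k - l)) \<le> s j * (- l * n)"
      by (simp add: algebra_simps power2_eq_square)
    then show ?thesis using pos by (simp only: mult_le_cancel_left_pos)
  qed
  have sum_s: "(\<Sum>j<m. s j) = n"
  proof -
    have "(\<Sum>j<m. s j) = (\<Sum>v\<in>V. \<Sum>j<m. a j v)"
      by (subst sum.swap) (simp add: sum_a)
    also have "\<dots> = (\<Sum>v\<in>V. 1)"
      using cm by (intro sum.cong) (auto simp: a_def)
    finally show ?thesis by (simp add: n_def)
  qed
  \<comment> \<open>By \<open>ml\<close>, the total slack is \<open>n * (\<theta> 1 - k)\<close>.
    Each slack is nonnegative, so all of them are 0.\<close>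
  have gap: "(\<Sum>j<m. - l * n - s j * (k - l)) \<le> 0"
  proof -
    have "(\<Sum>j<m. - l * n - s j * (k - l)) = - (l * real m) * n - n * (k - l)"
      by (simp add: sum_subtractf sum_s flip: sum_distrib_right)
    also have "\<dots> = n * (\<theta> 1 - k)" unfolding ml by (simp add: algebra_simps)
    also have "\<dots> \<le> 0" using n th1 by (simp add: mult_nonneg_nonpos)
    finally show ?thesis .
  qed
  have s_eq: "s j * (k - l) = - l * n" if j: "j < m" for j
  proof -
    have "- l * n - s j * (k - l) \<le> (\<Sum>j<m. - l * n - s j * (k - l))"
      using j ratio by (intro member_le_sum) auto
    then show ?thesis using gap ratio[of j] by linarith
  qed
  have kl: "k - l > 0" using l by simp
  \<comment> \<open>Outside class \<open>j\<close> the eigenvector has the value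
    \<open>- s j / n\<close>; solving its equation there for \<open>d v j\<close> gives
    \<open>s j * (k - l) / n\<close>, which the tight ratio bound evaluates to
    \<open>- l\<close>.\<close>
  have d_eq: "real (d v j) = - l" if v: "v \<in> V" and j: "j < m" and cv: "c v \<noteq> j" for v j
  proof -
    have "- k * (s j)\<^sup>2 / n = l * (s j - (s j)\<^sup>2 / n)"
    proof -
      have "s j * (s j * (k - l)) = s j * (- l * n)" using s_eq[OF j] by simp
      then show ?thesis using n by (simp add: field_simps power2_eq_square)
    qed
    then have "(\<Sum>u\<in>neighbours E v. f j u) = l * f j v"
      using least_adjacency_eigenvalue(2)[OF G th _ v, of "f j"] by (simp only: N Q l_def)
    then have "d v j - k * s j / n = - l * s j / n"
      using cv by (simp add: sum_fN[OF v]) (simp add: f_def a_def)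
    moreover have "s j * (k - l) / n = k * s j / n - l * s j / n"
      by (simp add: diff_divide_distrib right_diff_distrib mult.commute)
    ultimately have "d v j = s j * (k - l) / n" by simp
    then show ?thesis using s_eq[OF j] n by simp
  qed
  show thesis
  proof
    \<comment> \<open>The witness must be a natural number chosen before \<open>j\<close>. Rounding
      the common real value provides one, and the rounding is exact because the value equals a
      cardinality.\<close>
    show "card {v \<in> V. c v = j} = nat \<lfloor>- l * n / (k - l)\<rfloor>" if "j < m" for j
    proof -
      have "- l * n / (k - l) = s j" using s_eq[OF that] kl by (simp add: field_simps)
      then show ?thesis by (simp add: s_def)
    qed
    show "card {u \<in> neighbours E v. c u = j} = nat \<lfloor>- l\<rfloor>"
      if "v \<in> V" "j < m" "c v \<noteq> j" for v j
      using d_eq[OF that] unfolding d_def by (metis floor_of_nat nat_int)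
  qed
qed

section \<open>Edge colourings from equitable vertex colourings\<close>

text \<open>The least number of colours is attained as soon as some colouring exists; giving every
  vertex its own colour is one.\<close>

lemma obtain_optimal_vertex_colouring:
  assumes "simple_graph V E"
  obtains c where "proper_vertex_colouring V E (chromatic_number V E) c"
proof -
  have finV: "finite V" and EV: "E \<subseteq> all_edges V" using assms by (auto simp: simple_graph_def)
  obtain g where g: "bij_betw g V {0..<card V}" using ex_bij_betw_finite_nat[OF finV] by blast
  have "proper_vertex_colouring V E (card V) g"
    unfolding proper_vertex_colouring_def
  proof (intro conjI ballI impI)
    show "g v < card V" if "v \<in> V" for v using that g by (auto simp: bij_betw_def)
    fix u v assume "u \<in> V" "v \<in> V" "{u, v} \<in> E"
    moreover from this have "u \<noteq> v" using EV doubleton_in_all_edges_iff by fast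
    ultimately show "g u \<noteq> g v" using g by (auto simp: bij_betw_def inj_on_def)
  qed
  then have "\<exists>m c. proper_vertex_colouring V E m c" by blast
  then have "\<exists>c. proper_vertex_colouring V E (chromatic_number V E) c"
    unfolding chromatic_number_def by (rule LeastI_ex)
  then show thesis using that by blast
qed

text \<open>All that is kept of the eigenvalue hypotheses; from here on the argument is purely
  combinatorial.\<close>

locale equitable_colouring =
  fixes V :: "'a set" and E :: "'a set set" and m s t :: nat and c :: "'a \<Rightarrow> nat"
  assumes G: "simple_graph V E" and nonempty: "V \<noteq> {}"
    and colouring: "proper_vertex_colouring V E m c"
    and class_card: "\<And>j. j < m \<Longrightarrow> card {v \<in> V. c v = j} = s"
    and class_neighbours:
      "\<And>v j. v \<in> V \<Longrightarrow> j < m \<Longrightarrow> c v \<noteq> j \<Longrightarrow> card {u \<in> neighbours E v. c u = j} = t"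
    and even_m: "even m"
begin

definition cls :: "nat \<Rightarrow> 'a set" where
  "cls j = {v \<in> V. c v = j}"

abbreviation F :: "'a set set" where
  "F \<equiv> complement_edges V E"

lemma finite_V: "finite V" and E_subset: "E \<subseteq> all_edges V" and F_subset: "F \<subseteq> all_edges V"
  using G by (auto simp: simple_graph_def complement_edges_def)

lemma colour_less: "v \<in> V \<Longrightarrow> c v < m"
  using colouring by (simp add: proper_vertex_colouring_def)

lemma m_ge_2: "m \<ge> 2"
proof -
  obtain v where "v \<in> V" using nonempty by blast
  then have "m \<noteq> 0" using colour_less by fastforce
  then show ?thesis using even_m by (cases "m = 1") auto
qed

lemma finite_cls: "finite (cls j)"
  using finite_V by (simp add: cls_def)

lemma card_cls: "j < m \<Longrightarrow> card (cls j) = s"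
  using class_card by (simp add: cls_def)

lemma cls_disjoint: "i \<noteq> j \<Longrightarrow> cls i \<inter> cls j = {}"
  by (auto simp: cls_def)

lemma s_pos: "s > 0"
proof -
  obtain v where "v \<in> V" using nonempty by blast
  then have "card (cls (c v)) \<noteq> 0" using finite_cls by (auto simp: cls_def)
  then show ?thesis using card_cls colour_less \<open>v \<in> V\<close> by simp
qed

lemma E_colours_differ: "{u, v} \<in> E \<Longrightarrow> c u \<noteq> c v"
  using colouring E_subset doubleton_in_all_edges_iff[of u v V]
  by (auto simp: proper_vertex_colouring_def)

lemma neighbours_complement:
  assumes "v \<in> V"
  shows "neighbours F v = V - {v} - neighbours E v"
  using assms by (auto simp: neighbours_def complement_edges_def doubleton_in_all_edges_iff)

lemma finite_neighbours: "finite (neighbours E v)"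
  using neighbours_subset[OF E_subset] finite_V by (meson finite_Diff finite_subset)

text \<open>Between classes the complement has the same shape as the graph, with
  \<open>s - t\<close> in place of \<open>t\<close>, so one colouring lemma serves both.\<close>

lemma class_neighbours_complement:
  assumes "v \<in> V" "j < m" "c v \<noteq> j"
  shows "card {u \<in> neighbours F v. c u = j} = s - t"
proof -
  have "{u \<in> neighbours F v. c u = j} = cls j - {u \<in> neighbours E v. c u = j}"
    using neighbours_complement[OF assms(1)] assms(3) by (auto simp: cls_def)
  moreover have "{u \<in> neighbours E v. c u = j} \<subseteq> cls j"
    using neighbours_subset[OF E_subset, of v] by (auto simp: cls_def)
  ultimately show ?thesis
    using finite_neighbours assms card_cls class_neighbours by (simp add: card_Diff_subset)
qed

text \<open>Makes the truncated subtraction \<open>s - t\<close> exact.\<close>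

lemma t_le_s: "t \<le> s"
proof -
  obtain v where v: "v \<in> V" using nonempty by blast
  define j where "j = (if c v = 0 then 1 else 0 :: nat)"
  have j: "j < m" "c v \<noteq> j" using m_ge_2 by (auto simp: j_def)
  have "{u \<in> neighbours E v. c u = j} \<subseteq> cls j"
    using neighbours_subset[OF E_subset, of v] by (auto simp: cls_def)
  then have "card {u \<in> neighbours E v. c u = j} \<le> card (cls j)"
    using finite_cls by (rule card_mono[rotated])
  then show ?thesis using class_neighbours[OF v j] card_cls[OF j(1)] by simp
qed

lemma card_V: "card V = m * s"
proof -
  have "V = (\<Union>j<m. cls j)" using colour_less by (auto simp: cls_def)
  also have "card \<dots> = (\<Sum>j<m. card (cls j))"
    using finite_cls cls_disjoint by (intro card_UN_disjoint) auto
  finally show ?thesis using card_cls by simp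
qed

lemma regular_E: "regular V E ((m - 1) * t)"
  unfolding regular_def
proof
  fix v assume v: "v \<in> V"
  let ?N = "\<lambda>j. {u \<in> neighbours E v. c u = j}"
  have "neighbours E v = (\<Union>j\<in>{..<m} - {c v}. ?N j)"
    using neighbours_subset[OF E_subset, of v] colour_less E_colours_differ
    by (auto simp: neighbours_def insert_commute)
  also have "card \<dots> = (\<Sum>j\<in>{..<m} - {c v}. card (?N j))"
    using finite_neighbours by (intro card_UN_disjoint) auto
  also have "\<dots> = (\<Sum>j\<in>{..<m} - {c v}. t)"
    using class_neighbours[OF v] by (intro sum.cong) auto
  also have "\<dots> = (m - 1) * t" using colour_less[OF v] by simp
  finally show "vertex_degree E v = (m - 1) * t"
    by (simp add: vertex_degree_eq_card_neighbours[OF E_subset])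
qed

text \<open>The degree is written as the sum of the two palettes to be used:
  \<open>s - 1 + (s - t)\<close> colours for paired classes and \<open>s - t\<close> for each of the
  \<open>m - 2\<close> remaining 1-factors.\<close>

lemma regular_F: "regular V F ((s - 1 + (s - t)) + (m - 2) * (s - t))"
  unfolding regular_def
proof
  fix v assume v: "v \<in> V"
  have "neighbours E v \<subseteq> V - {v}" using neighbours_subset[OF E_subset] .
  then have "card (V - {v} - neighbours E v) = m * s - 1 - (m - 1) * t"
    using v finite_neighbours finite_V card_V regular_E
    by (simp add: card_Diff_subset regular_def vertex_degree_eq_card_neighbours[OF E_subset])
  also have "\<dots> = (s - 1 + (s - t)) + (m - 2) * (s - t)"
  proof -
    obtain p where p: "m = Suc (Suc p)" using m_ge_2 by (metis add_2_eq_Suc le_Suc_ex)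
    obtain q where q: "s = Suc q" using s_pos by (cases s) auto
    obtain r where r: "s = t + r" using t_le_s le_Suc_ex by blast
    have "m * s = Suc q + (m - 1) * (t + r)" using p q r by simp
    then show ?thesis using q r p by (simp add: algebra_simps)
  qed
  finally show "vertex_degree F v = (s - 1 + (s - t)) + (m - 2) * (s - t)"
    by (simp add: vertex_degree_eq_card_neighbours[OF F_subset] neighbours_complement[OF v])
qed

lemma regular_between_classes:
  assumes H: "H \<subseteq> all_edges V"
    and deg: "\<And>v j. v \<in> V \<Longrightarrow> j < m \<Longrightarrow> c v \<noteq> j \<Longrightarrow> card {u \<in> neighbours H v. c u = j} = d"
    and ij: "i < m" "j < m" "i \<noteq> j"
  shows "{e \<in> H. c ` e = {i, j}} \<subseteq> edges_between (cls i) (cls j)"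
    and "regular (cls i \<union> cls j) {e \<in> H. c ` e = {i, j}} d"
proof -
  let ?B = "{e \<in> H. c ` e = {i, j}}"
  show "?B \<subseteq> edges_between (cls i) (cls j)"
  proof
    fix e assume e: "e \<in> ?B"
    then have "e \<in> all_edges V" using H by blast
    then obtain u v where uv: "e = {u, v}" "u \<in> V" "v \<in> V" by (rule all_edgesE)
    have "(c u = i \<and> c v = j) \<or> (c u = j \<and> c v = i)"
      using e uv(1) ij(3) by (auto simp: doubleton_eq_iff)
    then show "e \<in> edges_between (cls i) (cls j)"
      using uv by (auto simp: edges_between_def cls_def)
  qed
  have *: "vertex_degree ?B v = d" if v: "v \<in> V" "c v = a" and ab: "{i, j} = {a, b}" "a \<noteq> b" "b < m" for v a b
  proof -
    have "neighbours ?B v = {u \<in> neighbours H v. c u = b}"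
      using v ab by (auto simp: neighbours_def doubleton_eq_iff)
    moreover have "?B \<subseteq> all_edges V" using H by blast
    ultimately show ?thesis
      using deg[of v b] v ab by (simp add: vertex_degree_eq_card_neighbours)
  qed
  show "regular (cls i \<union> cls j) ?B d"
    using *[of _ i j] *[of _ j i] ij by (auto simp: regular_def cls_def insert_commute)
qed

text \<open>The quotient map sends an edge to the set of colours of its ends, and its fibres are
  regular bipartite graphs. A general \<open>Q\<close> makes it possible to leave out one 1-factor,
  as the complement requires.\<close>

lemma edge_colourable_between:
  assumes H: "H \<subseteq> all_edges V"
    and deg: "\<And>v j. v \<in> V \<Longrightarrow> j < m \<Longrightarrow> c v \<noteq> j \<Longrightarrow> card {u \<in> neighbours H v. c u = j} = d"
    and Q: "Q \<subseteq> all_edges {..<m}" "edge_colourable Q q"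
  shows "edge_colourable {e \<in> H. c ` e \<in> Q} (q * d)"
proof (rule edge_colourable_quotient[where h = "\<lambda>e. c ` e", OF _ _ Q(2)])
  fix g assume g: "g \<in> Q"
  then obtain i j where ij: "g = {i, j}" "i \<noteq> j" "i < m" "j < m"
    using Q(1) by (blast elim: all_edgesE)
  have "{e \<in> {e \<in> H. c ` e \<in> Q}. c ` e = g} = {e \<in> H. c ` e = {i, j}}" using g ij by auto
  then show "edge_colourable {e \<in> {e \<in> H. c ` e \<in> Q}. c ` e = g} d"
    using edge_colourable_regular_bipartite[OF finite_cls finite_cls cls_disjoint[OF ij(2)]]
      regular_between_classes[OF H deg ij(3,4,2)] by simp
qed auto

lemma class_1_E: "class_1 V E"
proof (rule regular_class_1I[OF nonempty regular_E])
  have "edge_colourable (all_edges {..<m}) (m - 1)"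
    using edge_colourable_complete_even[of "{..<m}"] even_m by simp
  then have "edge_colourable {e \<in> E. c ` e \<in> all_edges {..<m}} ((m - 1) * t)"
    using edge_colourable_between[OF E_subset class_neighbours] by blast
  moreover have "c ` e \<in> all_edges {..<m}" if e: "e \<in> E" for e
  proof -
    have "e \<in> all_edges V" using e E_subset by blast
    then obtain u v where uv: "e = {u, v}" "u \<in> V" "v \<in> V" by (rule all_edgesE)
    then show ?thesis using colour_less E_colours_differ e by (auto intro!: all_edgesI)
  qed
  then have "{e \<in> E. c ` e \<in> all_edges {..<m}} = E" by blast
  ultimately show "edge_colourable E ((m - 1) * t)" by simp
qed

text \<open>The \<open>m - 1\<close> pairs containing \<open>i\<close> have different colours out of
  \<open>m - 1\<close>, so every colour occurs at \<open>i\<close>, in particular 0; no class stays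
  unpaired.\<close>

lemma perfect_matching_of_colours:
  assumes r: "proper_edge_colouring (all_edges {..<m}) (m - 1) r" and i: "i < m"
  obtains g where "g \<in> all_edges {..<m}" "r g = 0" "i \<in> g"
proof -
  let ?S = "{g \<in> all_edges {..<m}. i \<in> g}"
  have "neighbours (all_edges {..<m}) i = {..<m} - {i}"
    using i by (auto simp: neighbours_def doubleton_in_all_edges_iff)
  then have "card ?S = m - 1"
    using vertex_degree_eq_card_neighbours[of "all_edges {..<m}" "{..<m}" i] i
    by (simp add: vertex_degree_def)
  moreover have "inj_on r ?S"
  proof (rule inj_onI)
    fix g h assume "g \<in> ?S" "h \<in> ?S" "r g = r h"
    then show "g = h" using r unfolding proper_edge_colouring_def by blast
  qed
  ultimately have "card (r ` ?S) = card {..<m - 1}" by (simp add: card_image)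
  moreover have "r ` ?S \<subseteq> {..<m - 1}" using r by (auto simp: proper_edge_colouring_def)
  ultimately have "r ` ?S = {..<m - 1}" by (intro card_subset_eq) auto
  moreover have "0 \<in> {..<m - 1}" using m_ge_2 by simp
  ultimately have "0 \<in> r ` ?S" by simp
  then show thesis using that by force
qed

text \<open>The classes are paired up by the edges of colour 0 of a 1-factorisation \<open>r\<close> of the
  complete graph on the colours; the cliques are treated together with the bipartite graphs
  between paired classes.\<close>

lemma class_1_F:
  assumes "even s \<or> t < s"
  shows "class_1 V F"
proof (rule regular_class_1I[OF nonempty regular_F])
  let ?K = "all_edges {..<m}"
  obtain r where r: "proper_edge_colouring ?K (m - 1) r"
    using edge_colourable_complete_even[of "{..<m}"] even_m by auto
  define Q0 where "Q0 = {g \<in> ?K. r g = 0}"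
  define Q1 where "Q1 = {g \<in> ?K. r g \<noteq> 0}"
  have "edge_colourable Q1 (m - 2)"
  proof -
    have "proper_edge_colouring Q1 (m - 2) (\<lambda>g. r g - 1)"
      unfolding proper_edge_colouring_def
    proof (intro conjI ballI impI)
      fix g assume "g \<in> Q1"
      then have "r g < m - 1" "r g \<noteq> 0" using r by (auto simp: Q1_def proper_edge_colouring_def)
      then show "r g - 1 < m - 2" by simp
    next
      fix g h assume *: "g \<in> Q1" "h \<in> Q1" "g \<noteq> h \<and> g \<inter> h \<noteq> {}"
      then have "r g \<noteq> r h" using r unfolding proper_edge_colouring_def Q1_def by blast
      moreover have "r g \<noteq> 0" "r h \<noteq> 0" using * by (auto simp: Q1_def)
      ultimately show "r g - 1 \<noteq> r h - 1" by arith
    qed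
    then show ?thesis by blast
  qed
  moreover have "Q1 \<subseteq> ?K" by (auto simp: Q1_def)
  ultimately have F1: "edge_colourable {e \<in> F. c ` e \<in> Q1} ((m - 2) * (s - t))"
    using edge_colourable_between[OF F_subset class_neighbours_complement] by blast
  have Q0_unique: "g = h" if "g \<in> Q0" "h \<in> Q0" "i \<in> g" "i \<in> h" for g h i
    using that r unfolding proper_edge_colouring_def Q0_def by fastforce
  \<comment> \<open>The pairs in \<open>Q0\<close> are disjoint, so all of them can reuse a single
    palette.\<close>
  have Q0_colourable: "edge_colourable Q0 1"
  proof -
    have "proper_edge_colouring Q0 1 (\<lambda>_. 0)"
      unfolding proper_edge_colouring_def
    proof (intro conjI ballI impI)
      fix g h assume gh: "g \<in> Q0" "h \<in> Q0" "g \<noteq> h \<and> g \<inter> h \<noteq> {}"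
      then obtain i where "i \<in> g" "i \<in> h" by blast
      then have False using Q0_unique gh by metis
      then show "0 \<noteq> 0" ..
    qed simp
    then show ?thesis by blast
  qed
  \<comment> \<open>Inclusion instead of equality, so that edges inside a class, whose ends have
    only one colour, are assigned to the pair containing it.\<close>
  define F0 where "F0 = {e \<in> F. \<exists>g\<in>Q0. c ` e \<subseteq> g}"
  have "\<forall>e\<in>F0. \<exists>g. g \<in> Q0 \<and> c ` e \<subseteq> g" by (auto simp: F0_def)
  from bchoice[OF this] obtain h where h: "\<And>e. e \<in> F0 \<Longrightarrow> h e \<in> Q0 \<and> c ` e \<subseteq> h e"
    by blast
  have F0: "edge_colourable F0 (1 * (s - 1 + (s - t)))"
  proof (rule edge_colourable_quotient[where h = h, OF _ _ Q0_colourable])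
    show "h e \<in> Q0" if "e \<in> F0" for e using h[OF that] by blast
    show "h e \<inter> h f \<noteq> {}" if "e \<in> F0" "f \<in> F0" "e \<inter> f \<noteq> {}" for e f
      using h[OF that(1)] h[OF that(2)] that(3) by blast
    fix g assume g: "g \<in> Q0"
    then have "g \<in> ?K" by (simp add: Q0_def)
    then obtain i j where ij: "g = {i, j}" "i \<noteq> j" "i < m" "j < m"
      by (rule all_edgesE) auto
    let ?B = "{e \<in> F. c ` e = {i, j}}"
    have "edge_colourable (all_edges (cls i) \<union> all_edges (cls j) \<union> ?B) (card (cls i) - 1 + (s - t))"
    proof (rule edge_colourable_two_cliques_regular_bipartite)
      show "?B \<subseteq> edges_between (cls i) (cls j)" "regular (cls i \<union> cls j) ?B (s - t)"
        using regular_between_classes[OF F_subset class_neighbours_complement ij(3,4,2)] by auto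
    qed (use ij card_cls finite_cls cls_disjoint assms in auto)
    moreover have "{e \<in> F0. h e = g} \<subseteq> all_edges (cls i) \<union> all_edges (cls j) \<union> ?B"
    proof
      fix e assume e: "e \<in> {e \<in> F0. h e = g}"
      then have "e \<in> all_edges V" using F_subset by (auto simp: F0_def)
      then obtain u v where uv: "e = {u, v}" "u \<noteq> v" "u \<in> V" "v \<in> V" by (rule all_edgesE)
      have "c u \<in> {i, j}" "c v \<in> {i, j}" using h[of e] e uv ij by auto
      moreover have "e \<in> F" using e by (simp add: F0_def)
      ultimately show "e \<in> all_edges (cls i) \<union> all_edges (cls j) \<union> ?B"
        using uv by (auto simp: doubleton_in_all_edges_iff cls_def)
    qed
    ultimately show "edge_colourable {e \<in> F0. h e = g} (s - 1 + (s - t))"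
      unfolding card_cls[OF ij(3)] by (rule edge_colourable_subset)
  qed
  have "F \<subseteq> F0 \<union> {e \<in> F. c ` e \<in> Q1}"
  proof
    fix e assume e: "e \<in> F"
    then have "e \<in> all_edges V" using F_subset by blast
    then obtain u v where uv: "e = {u, v}" "u \<noteq> v" "u \<in> V" "v \<in> V" by (rule all_edgesE)
    show "e \<in> F0 \<union> {e \<in> F. c ` e \<in> Q1}"
    proof (cases "c u = c v")
      case True
      obtain g where "g \<in> ?K" "r g = 0" "c u \<in> g"
        using perfect_matching_of_colours[OF r colour_less[OF uv(3)]] .
      then show ?thesis using e uv True by (auto simp: F0_def Q0_def)
    next
      case False
      then have "c ` e \<in> ?K" using uv colour_less by (auto intro!: all_edgesI)
      then show ?thesis using e by (cases "r (c ` e) = 0") (auto simp: F0_def Q0_def Q1_def)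
    qed
  qed
  then have "F0 \<union> {e \<in> F. c ` e \<in> Q1} = F" by (auto simp: F0_def)
  then show "edge_colourable F ((s - 1 + (s - t)) + (m - 2) * (s - t))"
    using edge_colourable_Un[OF F0 F1] by simp
qed

text \<open>For \<open>t = s\<close> every vertex is adjacent in the graph to all of every other
  class, so the complement keeps only the edges inside classes, and these are all present.\<close>

lemma disjoint_union_of_odd_cliques_F:
  assumes "odd s" "t = s"
  shows "disjoint_union_of_odd_cliques V F"
proof -
  have "partition_on V (cls ` {..<m})"
  proof (rule partition_onI)
    show "\<Union>(cls ` {..<m}) = V" using colour_less by (auto simp: cls_def)
    show "disjnt p q" if pq: "p \<in> cls ` {..<m}" "q \<in> cls ` {..<m}" "p \<noteq> q" for p q
    proof -
      obtain i j where "p = cls i" "q = cls j" using pq by blast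
      then show ?thesis using pq(3) cls_disjoint[of i j] by (auto simp: disjnt_def)
    qed
    show "{} \<notin> cls ` {..<m}"
    proof
      assume "{} \<in> cls ` {..<m}"
      then obtain j where "j < m" "cls j = {}" by auto
      then show False using card_cls[of j] s_pos by simp
    qed
  qed
  moreover have "F = (\<Union>C\<in>cls ` {..<m}. all_edges C)"
  proof (intro equalityI subsetI)
    fix e assume e: "e \<in> F"
    then have "e \<in> all_edges V" using F_subset by blast
    then obtain u v where uv: "e = {u, v}" "u \<noteq> v" "u \<in> V" "v \<in> V" by (rule all_edgesE)
    have "c u = c v"
    proof (rule ccontr)
      assume ne: "c u \<noteq> c v"
      have "card {w \<in> neighbours F u. c w = c v} = 0"
        using class_neighbours_complement[OF uv(3) colour_less[OF uv(4)] ne] assms(2) by simp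
      moreover have "finite {w \<in> neighbours F u. c w = c v}"
        using neighbours_complement[OF uv(3)] finite_V by simp
      moreover have "v \<in> neighbours F u" using e uv(1) by (simp add: neighbours_def)
      ultimately show False by auto
    qed
    then show "e \<in> (\<Union>C\<in>cls ` {..<m}. all_edges C)"
      using uv colour_less by (auto simp: doubleton_in_all_edges_iff cls_def)
  next
    fix e assume "e \<in> (\<Union>C\<in>cls ` {..<m}. all_edges C)"
    then obtain j where "e \<in> all_edges (cls j)" by blast
    then obtain u v where "e = {u, v}" "u \<noteq> v" "u \<in> cls j" "v \<in> cls j" by (rule all_edgesE)
    then show "e \<in> F"
      using E_colours_differ[of u v] by (auto simp: complement_edges_def doubleton_in_all_edges_iff cls_def)
  qed
  moreover have "\<forall>C\<in>cls ` {..<m}. odd (card C)" using card_cls assms(1) by auto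
  ultimately show ?thesis unfolding disjoint_union_of_odd_cliques_def by blast
qed

end

theorem theorem2p3:
  fixes V :: "'a set" and E :: "'a set set" and k n :: nat and \<theta> :: "nat \<Rightarrow> real"
  assumes "simple_graph V E"
    and "V \<noteq> {}"
    and "n = card V"
    and "regular V E k"
    and "adjacency_eigenvalues V E \<theta>"
    and "even (chromatic_number V E)"
    and "real (chromatic_number V E) = 1 - \<theta> 1 / \<theta> n"
  shows "(class_1 V E \<and> class_1 V (complement_edges V E)) \<or>
         disjoint_union_of_odd_cliques V (complement_edges V E)"
proof -
  let ?m = "chromatic_number V E"
  obtain c where c: "proper_vertex_colouring V E ?m c"
    using obtain_optimal_vertex_colouring[OF assms(1)] .
  obtain v where "v \<in> V" using assms(2) by blast
  then have "?m \<noteq> 0" using c by (auto simp: proper_vertex_colouring_def)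
  then have m: "?m \<ge> 2" using assms(6) by (cases "?m = 1") auto
  obtain s t where st: "\<And>j. j < ?m \<Longrightarrow> card {v \<in> V. c v = j} = s"
    "\<And>v j. v \<in> V \<Longrightarrow> j < ?m \<Longrightarrow> c v \<noteq> j \<Longrightarrow> card {u \<in> neighbours E v. c u = j} = t"
    using hoffman_colouring_equitable[OF assms(1,2,4,5) c m assms(7)[unfolded assms(3)]] by blast
  interpret equitable_colouring V E ?m s t c
    by unfold_locales (use assms c st in auto)
  show ?thesis
    using class_1_E class_1_F disjoint_union_of_odd_cliques_F t_le_s by (metis le_neq_implies_less)
qed

end
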